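(* Let $(X,\mu,G)$ and $(X,\mu,\Gamma)$ be measure-preserving actions of two countable amenable groups $G$ and $\Gamma$ on a standard probability space, with the same orbits. Let $\Sigma_Y$ be a sub-sigma-algebra on $X$ invariant under both actions, and such that both these actions on the corresponding factor space $(Y,\nu)$ are free. Then $$h(\mu,G\,|\,\Sigma_Y)=h(\mu,\Gamma\,|\,\Sigma_Y).$$
   Context: A countable amenable group means an infinite countable discrete group in which there is a Følner sequence, i.e. a sequence of finite subsets $F_n\subset G$ with $\lim_n |F_n\cap gF_n|/|F_n|=1$ for every $g\in G$. The two actions have the same orbits if $\{g(x):g\in G\}=\{\gamma(x):\gamma\in\Gamma\}$ for $\mu$-almost every $x$. A measure-preserving action is free if almost every point has trivial stabilizer. $(Y,\nu)$ is the factor space of $(X,\mu)$ corresponding to $\Sigma_Y$; since $\Sigma_Y$ is invariant under both groups, both act on $(Y,\nu)$ and the corresponding factor map $X\to Y$ is equivariant for both. Entropy: $H(\mu,\mathcal P)=-\sum_{P\in\mathcal P}\mu(P)\log\mu(P)$ for a finite measurable partition $\mathcal P$; $H(\mu,\mathcal P|\Theta)=\inf_{\mathcal Q}\bigl(H(\mu,\mathcal P\vee\mathcal Q)-H(\mu,\mathcal Q)\bigr)$ over finite $\Theta$-measurable partitions $\mathcal Q$; for a $G$-invariant sub-sigma-algebra $\Theta$, $h(\mu,G,\mathcal P|\Theta)=\lim_n\frac1{|F_n|}H\bigl(\mu,\bigvee_{g\in F_n}g^{-1}(\mathcal P)\,\big|\,\Theta\bigr)$ for any Følner sequence $(F_n)$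 in $G$, and $h(\mu,G|\Theta)=\sup_{\mathcal P}h(\mu,G,\mathcal P|\Theta)$ over all finite measurable partitions $\mathcal P$ of $X$; similarly for $\Gamma$. *)

theory Defs
  imports "HOL-Probability.Probability" "HOL-Algebra.Group_Action"
begin

section \<open>Standard probability spaces\<close>

definition standard_borel_space :: "'a measure \<Rightarrow> bool" where
  "standard_borel_space M \<longleftrightarrow>
     (\<exists>X. completely_metrizable_space X \<and> second_countable X \<and> topspace X = space M \<and>
          sets M = sigma_sets (space M) {U. openin X U})"

text \<open>Both usual conventions are admitted: a Borel probability measure on a Polish space,
  or the completion of one.\<close>

definition standard_prob_space :: "'a measure \<Rightarrow> bool" where
  "standard_prob_space M \<longleftrightarrow>
     (\<exists>B. standard_borel_space B \<and> prob_space B \<and> (M = B \<or> M = completion B))"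

section \<open>Countable amenable groups\<close>

definition folner_seq :: "('g, 'r) monoid_scheme \<Rightarrow> (nat \<Rightarrow> 'g set) \<Rightarrow> bool" where
  "folner_seq G F \<longleftrightarrow>
     (\<forall>n. finite (F n) \<and> F n \<noteq> {} \<and> F n \<subseteq> carrier G) \<and>
     (\<forall>g\<in>carrier G. (\<lambda>n. real (card (F n \<inter> (g <#\<^bsub>G\<^esub> F n))) / real (card (F n))) \<longlonglongrightarrow> 1)"

definition countable_amenable_group :: "('g, 'r) monoid_scheme \<Rightarrow> bool" where
  "countable_amenable_group G \<longleftrightarrow>
     group G \<and> countable (carrier G) \<and> infinite (carrier G) \<and> (\<exists>F. folner_seq G F)"

section \<open>Measure-preserving actions\<close>

definition pmp_action ::
  "'a measure \<Rightarrow> ('g, 'r) monoid_scheme \<Rightarrow> ('g \<Rightarrow> 'a \<Rightarrow> 'a) \<Rightarrow> bool" where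
  "pmp_action M G T \<longleftrightarrow>
     group_action G (space M) T \<and>
     (\<forall>g\<in>carrier G. T g \<in> M \<rightarrow>\<^sub>M M \<and> distr M M (T g) = M)"

definition free_action ::
  "'a measure \<Rightarrow> ('g, 'r) monoid_scheme \<Rightarrow> ('g \<Rightarrow> 'a \<Rightarrow> 'a) \<Rightarrow> bool" where
  "free_action M G T \<longleftrightarrow> (AE x in M. stabilizer G T x = {\<one>\<^bsub>G\<^esub>})"

definition same_orbits ::
  "'a measure \<Rightarrow> ('g, 'r) monoid_scheme \<Rightarrow> ('g \<Rightarrow> 'a \<Rightarrow> 'a) \<Rightarrow>
   ('h, 's) monoid_scheme \<Rightarrow> ('h \<Rightarrow> 'a \<Rightarrow> 'a) \<Rightarrow> bool" where
  "same_orbits M G T K U \<longleftrightarrow> (AE x in M. orbit G T x = orbit K U x)"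

section \<open>Invariant sub-sigma-algebras and factor spaces\<close>

text \<open>A sub-sigma-algebra of \<open>M\<close> is represented by a measure \<open>S\<close> with \<open>subalgebra M S\<close>;
  only \<open>sets S\<close> matters, the measure carried by \<open>S\<close> is never used.\<close>

definition invariant_subalgebra ::
  "'a measure \<Rightarrow> ('g, 'r) monoid_scheme \<Rightarrow> ('g \<Rightarrow> 'a \<Rightarrow> 'a) \<Rightarrow> 'a measure \<Rightarrow> bool" where
  "invariant_subalgebra M G T S \<longleftrightarrow>
     subalgebra M S \<and> (\<forall>g\<in>carrier G. \<forall>A\<in>sets S. T g -` A \<inter> space M \<in> sets S)"

text \<open>\<open>N\<close> is the factor space of \<open>M\<close> corresponding to \<open>S\<close>, with factor map \<open>p\<close>: the standard
  probability space, unique up to isomorphism modulo null sets, whose sigma-algebra pulls back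
  to that of \<open>S\<close> modulo null sets.\<close>

definition factor_space :: "'a measure \<Rightarrow> 'a measure \<Rightarrow> 'b measure \<Rightarrow> ('a \<Rightarrow> 'b) \<Rightarrow> bool" where
  "factor_space M S N p \<longleftrightarrow>
     standard_prob_space N \<and> p \<in> M \<rightarrow>\<^sub>M N \<and> distr M N p = N \<and>
     (\<forall>B\<in>sets N. \<exists>A\<in>sets S. sym_diff A (p -` B \<inter> space M) \<in> null_sets M) \<and>
     (\<forall>A\<in>sets S. \<exists>B\<in>sets N. sym_diff A (p -` B \<inter> space M) \<in> null_sets M)"

text \<open>\<open>V\<close> is the action induced on the factor space, i.e. the one making \<open>p\<close> equivariant.\<close>

definition factor_action ::
  "'a measure \<Rightarrow> ('g, 'r) monoid_scheme \<Rightarrow> ('g \<Rightarrow> 'a \<Rightarrow> 'a) \<Rightarrow>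
   'b measure \<Rightarrow> ('a \<Rightarrow> 'b) \<Rightarrow> ('g \<Rightarrow> 'b \<Rightarrow> 'b) \<Rightarrow> bool" where
  "factor_action M G T N p V \<longleftrightarrow>
     pmp_action N G V \<and> (\<forall>g\<in>carrier G. AE x in M. p (T g x) = V g (p x))"

section \<open>Conditional entropy\<close>

definition finite_partitions :: "'a measure \<Rightarrow> 'a set set set" where
  "finite_partitions M = {P. finite P \<and> P \<subseteq> sets M \<and> partition_on (space M) P}"

definition part_entropy :: "'a measure \<Rightarrow> 'a set set \<Rightarrow> real" where
  "part_entropy M P = - (\<Sum>A\<in>P. measure M A * ln (measure M A))"

text \<open>The join of finitely many partitions is \<^const>\<open>common_refinement\<close> of the set of
  these partitions.\<close>

definition cond_part_entropy :: "'a measure \<Rightarrow> 'a measure \<Rightarrow> 'a set set \<Rightarrow> real" where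
  "cond_part_entropy M S P =
     (INF Q\<in>finite_partitions S. part_entropy M (common_refinement {P, Q}) - part_entropy M Q)"

definition pullback_partition :: "'a measure \<Rightarrow> ('a \<Rightarrow> 'a) \<Rightarrow> 'a set set \<Rightarrow> 'a set set" where
  "pullback_partition M f P = (\<lambda>A. f -` A \<inter> space M) ` P"

definition joined_partition ::
  "'a measure \<Rightarrow> ('g \<Rightarrow> 'a \<Rightarrow> 'a) \<Rightarrow> 'g set \<Rightarrow> 'a set set \<Rightarrow> 'a set set" where
  "joined_partition M T F P = common_refinement ((\<lambda>g. pullback_partition M (T g) P) ` F)"

text \<open>The common value of the limit along all Folner sequences.\<close>

definition action_part_entropy ::
  "'a measure \<Rightarrow> ('g, 'r) monoid_scheme \<Rightarrow> ('g \<Rightarrow> 'a \<Rightarrow> 'a) \<Rightarrow> 'a measure \<Rightarrow> 'a set set \<Rightarrow> real" where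
  "action_part_entropy M G T S P =
     (THE h. \<forall>F. folner_seq G F \<longrightarrow>
        (\<lambda>n. cond_part_entropy M S (joined_partition M T (F n) P) / real (card (F n))) \<longlonglongrightarrow> h)"

definition action_entropy ::
  "'a measure \<Rightarrow> ('g, 'r) monoid_scheme \<Rightarrow> ('g \<Rightarrow> 'a \<Rightarrow> 'a) \<Rightarrow> 'a measure \<Rightarrow> ereal" where
  "action_entropy M G T S =
     (SUP P\<in>finite_partitions M. ereal (action_part_entropy M G T S P))"

end

theory Submission
  imports Defs
begin

text \<open>
  Since the actions on the factor are free, a point \<open>x\<close> carries a bijection \<open>\<alpha>\<^sub>x : G \<rightarrow> \<Gamma>\<close> with
  \<open>g x = \<alpha>\<^sub>x(g) x\<close>, and for each \<open>g\<close> the map \<open>x \<mapsto> \<alpha>\<^sub>x(g)\<close> is \<open>\<Sigma>\<^sub>Y\<close>-measurable up to null sets. Conditionally on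
  \<open>\<Sigma>\<^sub>Y\<close>, the join of \<open>P\<close> over a Folner set \<open>F \<subseteq> G\<close> is therefore the join over the finite set
  \<open>\<alpha>\<^sub>x(F) \<subseteq> \<Gamma>\<close>, which for most \<open>x\<close> is almost invariant under any given finite part of \<open>\<Gamma>\<close>. For finite
  \<open>E \<subseteq> \<Gamma>\<close> the translates \<open>E\<gamma>\<close> cover \<open>\<alpha>\<^sub>x(F)\<close> exactly \<open>|E|\<close> times, so Shearer's inequality bounds its
  conditional entropy by \<open>|F| / |E|\<close> times that of \<open>E\<close>, up to a boundary term. Hence the averaged
  entropies along Folner sets of \<open>G\<close> are asymptotically below the infimum of the averaged entropies
  over all finite subsets of \<open>\<Gamma>\<close>. Applied to \<open>(G, G)\<close> this shows that the limit exists and is the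
  infimum for \<open>G\<close>; applied to \<open>(G, \<Gamma>)\<close> and \<open>(\<Gamma>, G)\<close> it shows that the infima agree. Disintegration
  is avoided by conditioning on a finite \<open>\<Sigma>\<^sub>Y\<close>-measurable partition on most of whose pieces
  \<open>\<alpha>\<^sub>x\<close> restricted to \<open>F\<close> is constant.
\<close>

section \<open>Entropy of finite-valued maps\<close>

definition eta :: "real \<Rightarrow> real" where
  "eta t = - (t * ln t)"

lemma eta_0 [simp]: "eta 0 = 0"
  by (simp add: eta_def)

text \<open>Subadditivity of entropy for a joint distribution of arbitrary total mass
  \<open>t\<close>, which is why \<open>eta t\<close> appears. The bound ln u \<le> u - 1 is applied
  to the quotient of \<open>r i * s j / t\<close> by \<open>m i j\<close>; the product distribution
  in the numerator has the same total mass as \<open>m\<close>, so the errors cancel in the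
  sum.\<close>

lemma eta_sum_le_matrix:
  fixes m :: "'i \<Rightarrow> 'j \<Rightarrow> real"
  assumes fin: "finite I" "finite J" and nonneg: "\<And>i j. i \<in> I \<Longrightarrow> j \<in> J \<Longrightarrow> 0 \<le> m i j"
  shows "(\<Sum>i\<in>I. \<Sum>j\<in>J. eta (m i j)) + eta (\<Sum>i\<in>I. \<Sum>j\<in>J. m i j)
    \<le> (\<Sum>i\<in>I. eta (\<Sum>j\<in>J. m i j)) + (\<Sum>j\<in>J. eta (\<Sum>i\<in>I. m i j))"
proof -
  define r where "r i = (\<Sum>j\<in>J. m i j)" for i
  define s where "s j = (\<Sum>i\<in>I. m i j)" for j
  define t where "t = (\<Sum>i\<in>I. \<Sum>j\<in>J. m i j)"
  have t_r: "t = (\<Sum>i\<in>I. r i)" by (simp add: t_def r_def)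
  have t_s: "t = (\<Sum>j\<in>J. s j)" unfolding t_def s_def by (rule sum.swap)
  have pointwise: "m i j * (ln (r i) + ln (s j) - ln (m i j) - ln t) \<le> r i * s j / t - m i j"
    if ij: "i \<in> I" "j \<in> J" for i j
  proof (cases "m i j = 0")
    case True
    have "0 \<le> r i" "0 \<le> s j" "0 \<le> t"
      unfolding r_def s_def t_def using nonneg ij by (auto intro!: sum_nonneg)
    then show ?thesis using True by simp
  next
    case False
    then have m: "0 < m i j" using nonneg[OF ij] by simp
    have "m i j \<le> r i" unfolding r_def using fin nonneg ij by (intro member_le_sum) auto
    with m have r: "0 < r i" by simp
    have "m i j \<le> s j" unfolding s_def using fin nonneg ij by (intro member_le_sum) auto
    with m have s: "0 < s j" by simp
    have "r i \<le> t" unfolding t_r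
      using fin nonneg ij by (intro member_le_sum) (auto simp: r_def intro!: sum_nonneg)
    with r have t: "0 < t" by simp
    have "ln (r i) + ln (s j) - ln (m i j) - ln t = ln (r i * s j / (m i j * t))"
      using m r s t by (simp add: ln_mult ln_div)
    also have "\<dots> \<le> r i * s j / (m i j * t) - 1"
      using m r s t by (intro ln_le_minus_one) simp
    finally have "m i j * (ln (r i) + ln (s j) - ln (m i j) - ln t)
        \<le> m i j * (r i * s j / (m i j * t) - 1)"
      using m by (intro mult_left_mono) auto
    also have "\<dots> = r i * s j / t - m i j"
      using m t by (simp add: field_simps)
    finally show ?thesis .
  qed
  have "(\<Sum>i\<in>I. \<Sum>j\<in>J. m i j * (ln (r i) + ln (s j) - ln (m i j) - ln t))
      \<le> (\<Sum>i\<in>I. \<Sum>j\<in>J. r i * s j / t - m i j)"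
    by (intro sum_mono pointwise)
  also have "\<dots> = (\<Sum>i\<in>I. r i) * (\<Sum>j\<in>J. s j) / t - t"
    by (simp add: sum_subtractf t_def sum_product sum_divide_distrib)
  \<comment> \<open>The equation t * t / t = t survives at t = 0, because division by zero yields
    zero.\<close>
  also have "\<dots> = 0"
    unfolding t_r[symmetric] t_s[symmetric] by simp
  finally have le: "(\<Sum>i\<in>I. \<Sum>j\<in>J. m i j * (ln (r i) + ln (s j) - ln (m i j) - ln t)) \<le> 0" .
  have 1: "(\<Sum>i\<in>I. \<Sum>j\<in>J. m i j * ln (r i)) = - (\<Sum>i\<in>I. eta (r i))"
    by (simp add: eta_def r_def sum_distrib_right sum_negf)
  have "(\<Sum>i\<in>I. \<Sum>j\<in>J. m i j * ln (s j)) = (\<Sum>j\<in>J. \<Sum>i\<in>I. m i j * ln (s j))"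
    by (rule sum.swap)
  also have "\<dots> = - (\<Sum>j\<in>J. eta (s j))"
    by (simp add: eta_def s_def sum_distrib_right sum_negf)
  finally have 2: "(\<Sum>i\<in>I. \<Sum>j\<in>J. m i j * ln (s j)) = - (\<Sum>j\<in>J. eta (s j))" .
  have 3: "(\<Sum>i\<in>I. \<Sum>j\<in>J. m i j * ln (m i j)) = - (\<Sum>i\<in>I. \<Sum>j\<in>J. eta (m i j))"
    by (simp add: eta_def sum_negf)
  have 4: "(\<Sum>i\<in>I. \<Sum>j\<in>J. m i j * ln t) = - eta t"
    by (simp add: eta_def t_def sum_distrib_right)
  have "(\<Sum>i\<in>I. \<Sum>j\<in>J. m i j * (ln (r i) + ln (s j) - ln (m i j) - ln t))
      = - (\<Sum>i\<in>I. eta (r i)) - (\<Sum>j\<in>J. eta (s j)) + (\<Sum>i\<in>I. \<Sum>j\<in>J. eta (m i j)) + eta t"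
    by (simp only: right_diff_distrib distrib_left sum.distrib sum_subtractf 1 2 3 4)
  with le show ?thesis unfolding r_def s_def t_def by simp
qed

text \<open>Merging cells lowers entropy: \<open>ln\<close> is monotone and every mass is at most
  the total.\<close>

lemma eta_sum_le:
  assumes fin: "finite I" and nonneg: "\<And>i. i \<in> I \<Longrightarrow> 0 \<le> (m i :: real)"
  shows "eta (\<Sum>i\<in>I. m i) \<le> (\<Sum>i\<in>I. eta (m i))"
proof -
  have "m i * ln (m i) \<le> m i * ln (\<Sum>i\<in>I. m i)" if i: "i \<in> I" for i
  proof (cases "m i = 0")
    case False
    then have "0 < m i" using nonneg[OF i] by simp
    moreover have "m i \<le> (\<Sum>i\<in>I. m i)" using fin nonneg i by (intro member_le_sum) auto
    ultimately show ?thesis by (intro mult_left_mono) auto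
  qed simp
  then have "(\<Sum>i\<in>I. m i * ln (m i)) \<le> (\<Sum>i\<in>I. m i * ln (\<Sum>i\<in>I. m i))"
    by (intro sum_mono)
  then show ?thesis by (simp add: eta_def sum_negf sum_distrib_right)
qed

text \<open>The uniform distribution has the largest entropy: ln u \<le> u - 1 is applied to the
  quotient of the mean mass by \<open>m i\<close>. The masses are not normalised, so the bound
  carries the total mass as a factor.\<close>

lemma sum_eta_le_ln_card:
  assumes fin: "finite I" and nonneg: "\<And>i. i \<in> I \<Longrightarrow> 0 \<le> (m i :: real)" and n: "card I \<le> n"
  shows "(\<Sum>i\<in>I. eta (m i)) - eta (\<Sum>i\<in>I. m i) \<le> (\<Sum>i\<in>I. m i) * ln n"
proof (cases "I = {}")
  case False
  then have c: "0 < card I" using fin by (simp add: card_gt_0_iff)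
  define t where "t = (\<Sum>i\<in>I. m i)"
  have t0: "0 \<le> t" unfolding t_def using nonneg by (intro sum_nonneg)
  have pointwise: "m i * (ln t - ln (m i) - ln (card I)) \<le> t / card I - m i" if i: "i \<in> I" for i
  proof (cases "m i = 0")
    case True
    then show ?thesis using t0 by simp
  next
    case False
    then have m: "0 < m i" using nonneg[OF i] by simp
    have "m i \<le> t" unfolding t_def using fin nonneg i by (intro member_le_sum) auto
    with m have t: "0 < t" by simp
    have "ln t - ln (m i) - ln (card I) = ln (t / (m i * card I))"
      using m t c by (simp add: ln_mult ln_div)
    also have "\<dots> \<le> t / (m i * card I) - 1"
      using m t c by (intro ln_le_minus_one) simp
    finally have "m i * (ln t - ln (m i) - ln (card I)) \<le> m i * (t / (m i * card I) - 1)"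
      using m by (intro mult_left_mono) auto
    also have "\<dots> = t / card I - m i"
      using m c by (simp add: field_simps)
    finally show ?thesis .
  qed
  have "(\<Sum>i\<in>I. m i * (ln t - ln (m i) - ln (card I))) \<le> (\<Sum>i\<in>I. t / card I - m i)"
    by (intro sum_mono pointwise)
  also have "\<dots> = 0" using c by (simp add: sum_subtractf t_def)
  finally have "(\<Sum>i\<in>I. eta (m i)) - eta t \<le> t * ln (card I)"
    by (simp add: algebra_simps sum_subtractf sum.distrib eta_def sum_negf sum_distrib_right t_def)
  also have "\<dots> \<le> t * ln n" using t0 c n by (intro mult_left_mono) auto
  finally show ?thesis by (simp add: t_def)
qed simp

section \<open>Entropy of a map on a measurable set\<close>

context finite_measure
begin

definition map_entropy :: "'a set \<Rightarrow> ('a \<Rightarrow> 'v) \<Rightarrow> real" where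
  "map_entropy D f = (\<Sum>v\<in>f ` D. eta (measure M {x\<in>D. f x = v}))"

text \<open>For \<open>D\<close> of positive measure this is \<open>measure M D\<close> times the
  Shannon entropy of \<open>f\<close> under the conditional probability on \<open>D\<close>. With
  the mass as a factor, contributions of disjoint pieces simply add up.\<close>

definition local_entropy :: "'a set \<Rightarrow> ('a \<Rightarrow> 'v) \<Rightarrow> real" where
  "local_entropy D f = map_entropy D f - eta (measure M D)"

lemma map_entropy_superset:
  assumes "finite V" "f ` D \<subseteq> V"
  shows "map_entropy D f = (\<Sum>v\<in>V. eta (measure M {x\<in>D. f x = v}))"
  unfolding map_entropy_def
proof (rule sum.mono_neutral_left)
  show "\<forall>v\<in>V - f ` D. eta (measure M {x\<in>D. f x = v}) = 0"
  proof
    fix v assume "v \<in> V - f ` D"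
    then have "{x\<in>D. f x = v} = {}" by auto
    then show "eta (measure M {x\<in>D. f x = v}) = 0" by (simp only: measure_empty eta_0)
  qed
qed (use assms in auto)

text \<open>Only the partition of \<open>D\<close> into fibres matters, so values can be relabelled,
  even in another type. Tuples and joint maps are rearranged with this rule throughout.\<close>

lemma map_entropy_kernel_cong:
  assumes "\<And>x y. x \<in> D \<Longrightarrow> y \<in> D \<Longrightarrow> f x = f y \<longleftrightarrow> g x = g y"
  shows "map_entropy D f = map_entropy D g"
proof -
  \<comment> \<open>\<open>h\<close> is the relabelling: it sends a value of \<open>g\<close> to the
    value of \<open>f\<close> at some point of that fibre.\<close>
  define h where "h v = f (SOME x. x \<in> D \<and> g x = v)" for v
  have h: "h (g x) = f x" if "x \<in> D" for x
  proof -
    have "(SOME y. y \<in> D \<and> g y = g x) \<in> D \<and> g (SOME y. y \<in> D \<and> g y = g x) = g x"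
      using that by (intro someI[of "\<lambda>y. y \<in> D \<and> g y = g x" x]) auto
    then show ?thesis unfolding h_def using assms that by blast
  qed
  have inj: "inj_on h (g ` D)" using assms by (auto simp: inj_on_def h)
  have img: "h ` g ` D = f ` D" by (auto simp: h image_iff)
  have "map_entropy D f = (\<Sum>v\<in>h ` g ` D. eta (measure M {x\<in>D. f x = v}))"
    by (simp add: map_entropy_def img)
  also have "\<dots> = (\<Sum>v\<in>g ` D. eta (measure M {x\<in>D. f x = h v}))"
    by (subst sum.reindex[OF inj]) simp
  also have "\<dots> = map_entropy D g"
    unfolding map_entropy_def
  proof (rule sum.cong)
    fix v assume "v \<in> g ` D"
    then obtain y where y: "y \<in> D" "v = g y" by auto
    then have "{x\<in>D. f x = h v} = {x\<in>D. g x = v}" using h assms by auto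
    then show "eta (measure M {x\<in>D. f x = h v}) = eta (measure M {x\<in>D. g x = v})" by simp
  qed simp
  finally show ?thesis .
qed

lemma local_entropy_kernel_cong:
  assumes "\<And>x y. x \<in> D \<Longrightarrow> y \<in> D \<Longrightarrow> f x = f y \<longleftrightarrow> g x = g y"
  shows "local_entropy D f = local_entropy D g"
  using map_entropy_kernel_cong[of D f g] assms by (simp add: local_entropy_def)

lemma fiber_in_sets:
  assumes f: "simple_function M f" and D: "D \<in> sets M"
  shows "{x\<in>D. f x = v} \<in> sets M"
proof -
  have "{x\<in>D. f x = v} = D \<inter> (f -` {v} \<inter> space M)"
    using sets.sets_into_space[OF D] by auto
  then show ?thesis using simple_functionD(2)[OF f, of "{v}"] D by simp
qed

lemma finite_image_simple:
  assumes f: "simple_function M f" and D: "D \<in> sets M"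
  shows "finite (f ` D)"
  using simple_functionD(1)[OF f] sets.sets_into_space[OF D] finite_subset[OF image_mono] by blast

lemma sum_measure_fibers:
  assumes f: "simple_function M f" and D: "D \<in> sets M" and V: "finite V" "f ` D \<subseteq> V"
  shows "(\<Sum>v\<in>V. measure M {x\<in>D. f x = v}) = measure M D"
proof -
  have "measure M (\<Union>v\<in>V. {x\<in>D. f x = v}) = (\<Sum>v\<in>V. measure M {x\<in>D. f x = v})"
    using V fiber_in_sets[OF f D]
    by (intro finite_measure_finite_Union) (auto simp: disjoint_family_on_def)
  moreover have "(\<Union>v\<in>V. {x\<in>D. f x = v}) = D" using V by auto
  ultimately show ?thesis by simp
qed

lemma measure_Int_conull:
  assumes A: "A \<in> sets M" and E: "E \<in> sets M" "measure M (space M - E) = 0"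
  shows "measure M (A \<inter> E) = measure M A"
proof -
  have "measure M (A - E) \<le> measure M (space M - E)"
    using A E sets.sets_into_space[OF A] by (intro finite_measure_mono) auto
  then have "measure M (A - E) = 0" using E by (simp add: measure_le_0_iff)
  moreover have "measure M A = measure M (A \<inter> E) + measure M (A - E)"
    using A E by (subst finite_measure_Union[symmetric]) (auto simp: Int_Diff_Un)
  ultimately show ?thesis by simp
qed

text \<open>The orbit identities hold only on a conull set; this lets a fibre be cut down to that
  set without changing its entropy.\<close>

lemma local_entropy_conull:
  assumes f: "simple_function M f" and D: "D \<in> sets M"
    and E: "E \<in> sets M" "measure M (space M - E) = 0"
  shows "local_entropy (D \<inter> E) f = local_entropy D f"
proof -
  note * = measure_Int_conull[OF _ E]
  have fin: "finite (f ` D)" by (rule finite_image_simple[OF f D])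
  have "map_entropy (D \<inter> E) f = (\<Sum>v\<in>f ` D. eta (measure M ({x\<in>D. f x = v} \<inter> E)))"
    by (subst map_entropy_superset[OF fin]) (auto intro!: sum.cong arg_cong[of _ _ eta] arg_cong[of _ _ "measure M"])
  also have "\<dots> = map_entropy D f"
    unfolding map_entropy_def using *[OF fiber_in_sets[OF f D]] by simp
  finally show ?thesis by (simp add: local_entropy_def *[OF D])
qed

lemma map_entropy_Pair:
  assumes f: "simple_function M f" and q: "simple_function M q" and D: "D \<in> sets M"
  shows "map_entropy D (\<lambda>x. (f x, q x)) = (\<Sum>w\<in>q ` D. map_entropy {x\<in>D. q x = w} f)"
proof -
  have fin: "finite (f ` D)" "finite (q ` D)" using finite_image_simple D f q by auto
  have "map_entropy D (\<lambda>x. (f x, q x))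
      = (\<Sum>z\<in>f ` D \<times> q ` D. eta (measure M {x\<in>D. (f x, q x) = z}))"
    by (rule map_entropy_superset) (use fin in auto)
  also have "\<dots> = (\<Sum>v\<in>f ` D. \<Sum>w\<in>q ` D. eta (measure M {x\<in>D. f x = v \<and> q x = w}))"
    by (simp add: sum.cartesian_product split_def prod_eq_iff)
  also have "\<dots> = (\<Sum>w\<in>q ` D. \<Sum>v\<in>f ` D. eta (measure M {x\<in>D. f x = v \<and> q x = w}))"
    by (rule sum.swap)
  also have "\<dots> = (\<Sum>w\<in>q ` D. map_entropy {x\<in>D. q x = w} f)"
  proof (rule sum.cong)
    fix w
    have "{x\<in>{x\<in>D. q x = w}. f x = v} = {x\<in>D. f x = v \<and> q x = w}" for v by auto
    then show "(\<Sum>v\<in>f ` D. eta (measure M {x\<in>D. f x = v \<and> q x = w})) = map_entropy {x\<in>D. q x = w} f"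
      by (subst map_entropy_superset[OF fin(1)]) auto
  qed simp
  finally show ?thesis .
qed

text \<open>The chain rule: grouping the fibres of the pair by the value of \<open>q\<close> leaves
  one conditional entropy per fibre of \<open>q\<close>, weighted by its mass.\<close>

lemma map_entropy_Pair_diff:
  assumes f: "simple_function M f" and q: "simple_function M q" and D: "D \<in> sets M"
  shows "map_entropy D (\<lambda>x. (f x, q x)) - map_entropy D q
    = (\<Sum>w\<in>q ` D. local_entropy {x\<in>D. q x = w} f)"
  unfolding map_entropy_Pair[OF assms] local_entropy_def
  by (simp add: map_entropy_def sum_subtractf)

text \<open>The joint masses form a matrix whose row and column sums are the masses of the fibres of
  \<open>f\<close> and \<open>q\<close>.\<close>

lemma map_entropy_subadditive:
  assumes f: "simple_function M f" and q: "simple_function M q" and D: "D \<in> sets M"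
  shows "map_entropy D (\<lambda>x. (f x, q x)) + eta (measure M D) \<le> map_entropy D f + map_entropy D q"
proof -
  have fin: "finite (f ` D)" "finite (q ` D)" using finite_image_simple D f q by auto
  define m where "m v w = measure M {x\<in>D. f x = v \<and> q x = w}" for v w
  have 1: "map_entropy D (\<lambda>x. (f x, q x)) = (\<Sum>v\<in>f ` D. \<Sum>w\<in>q ` D. eta (m v w))"
    by (subst map_entropy_superset[of "f ` D \<times> q ` D"])
      (use fin in \<open>auto simp: sum.cartesian_product split_def prod_eq_iff m_def\<close>)
  have row: "(\<Sum>w\<in>q ` D. m v w) = measure M {x\<in>D. f x = v}" for v
    using sum_measure_fibers[OF q fiber_in_sets[OF f D] fin(2), of v] by (auto simp: m_def)
  have col: "(\<Sum>v\<in>f ` D. m v w) = measure M {x\<in>D. q x = w}" for w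
    using sum_measure_fibers[OF f fiber_in_sets[OF q D] fin(1), of w]
    by (auto simp: m_def conj_ac)
  show ?thesis
    using eta_sum_le_matrix[of "f ` D" "q ` D" m, OF fin]
    unfolding 1 row col sum_measure_fibers[OF f D fin(1) order_refl]
    by (simp add: map_entropy_def m_def)
qed

text \<open>Strong subadditivity: plain subadditivity of \<open>f\<close> and \<open>q\<close> holds
  on each fibre of \<open>k\<close>, and the results are summed over the fibres.\<close>

lemma map_entropy_submodular:
  assumes f: "simple_function M f" and q: "simple_function M q" and k: "simple_function M k"
    and D: "D \<in> sets M"
  shows "map_entropy D (\<lambda>x. (f x, q x, k x)) + map_entropy D k
    \<le> map_entropy D (\<lambda>x. (f x, k x)) + map_entropy D (\<lambda>x. (q x, k x))"
proof -
  have fq: "simple_function M (\<lambda>x. (f x, q x))" using f q by (rule simple_function_Pair)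
  have "map_entropy D (\<lambda>x. (f x, q x, k x)) = map_entropy D (\<lambda>x. ((f x, q x), k x))"
    by (rule map_entropy_kernel_cong) auto
  also have "\<dots> + map_entropy D k
      = (\<Sum>w\<in>k ` D. map_entropy {x\<in>D. k x = w} (\<lambda>x. (f x, q x)) + eta (measure M {x\<in>D. k x = w}))"
    unfolding map_entropy_Pair[OF fq k D] sum.distrib by (simp only: map_entropy_def[of D k])
  also have "\<dots> \<le> (\<Sum>w\<in>k ` D. map_entropy {x\<in>D. k x = w} f + map_entropy {x\<in>D. k x = w} q)"
    by (intro sum_mono map_entropy_subadditive f q fiber_in_sets[OF k D])
  also have "\<dots> = map_entropy D (\<lambda>x. (f x, k x)) + map_entropy D (\<lambda>x. (q x, k x))"
    unfolding map_entropy_Pair[OF f k D] map_entropy_Pair[OF q k D] sum.distrib ..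
  finally show ?thesis by simp
qed

lemma local_entropy_nonneg:
  assumes f: "simple_function M f" and D: "D \<in> sets M"
  shows "0 \<le> local_entropy D f"
  using eta_sum_le[of "f ` D" "\<lambda>v. measure M {x\<in>D. f x = v}"] finite_image_simple[OF f D]
    sum_measure_fibers[OF f D finite_image_simple[OF f D]]
  by (simp add: local_entropy_def map_entropy_def)

lemma local_entropy_le_ln_card:
  assumes f: "simple_function M f" and D: "D \<in> sets M" and V: "finite V" "f ` D \<subseteq> V"
  shows "local_entropy D f \<le> measure M D * ln (card V)"
  using sum_eta_le_ln_card[of V "\<lambda>v. measure M {x\<in>D. f x = v}" "card V"] V
    sum_measure_fibers[OF f D V]
  by (simp add: local_entropy_def map_entropy_superset[OF V])

text \<open>The conditional entropy of \<open>f\<close> given \<open>q\<close>, written as a sum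
  over the fibres of \<open>q\<close> so that it can be estimated piece by piece.\<close>

definition cond_map_entropy :: "('a \<Rightarrow> 'v) \<Rightarrow> ('a \<Rightarrow> 'w) \<Rightarrow> real" where
  "cond_map_entropy f q = (\<Sum>w\<in>q ` space M. local_entropy {x\<in>space M. q x = w} f)"

text \<open>Conditioning on more lowers entropy. This is submodularity with \<open>r\<close> as the
  common part: since \<open>q\<close> determines \<open>r\<close>, adjoining \<open>r\<close> to
  \<open>q\<close> changes no fibre.\<close>

lemma cond_map_entropy_refine:
  assumes f: "simple_function M f" and q: "simple_function M q" and r: "simple_function M r"
    and ref: "\<And>x y. x \<in> space M \<Longrightarrow> y \<in> space M \<Longrightarrow> q x = q y \<Longrightarrow> r x = r y"
  shows "cond_map_entropy f q \<le> cond_map_entropy f r"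
proof -
  have eq: "map_entropy (space M) (\<lambda>x. (q x, r x)) = map_entropy (space M) q"
    by (rule map_entropy_kernel_cong) (metis ref prod.inject)
  have eq': "map_entropy (space M) (\<lambda>x. (f x, q x, r x)) = map_entropy (space M) (\<lambda>x. (f x, q x))"
    by (rule map_entropy_kernel_cong) (metis ref prod.inject)
  show ?thesis
    using map_entropy_submodular[OF f q r sets.top] map_entropy_Pair_diff[OF f q sets.top]
      map_entropy_Pair_diff[OF f r sets.top]
    unfolding cond_map_entropy_def eq eq' by linarith
qed

lemma map_entropy_comp:
  assumes f: "simple_function M f" and S: "S \<in> M \<rightarrow>\<^sub>M M" "distr M M S = M"
  shows "map_entropy (space M) (\<lambda>x. f (S x)) = map_entropy (space M) f"
proof -
  have fin: "finite (f ` space M)" by (rule simple_functionD(1)[OF f])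
  have "map_entropy (space M) (\<lambda>x. f (S x))
      = (\<Sum>v\<in>f ` space M. eta (measure M {x\<in>space M. f (S x) = v}))"
    \<comment> \<open>A value of \<open>f\<close> that is missed after composing with
      \<open>S\<close> has an empty fibre and contributes zero.\<close>
    using measurable_space[OF S(1)] by (intro map_entropy_superset fin) auto
  also have "\<dots> = (\<Sum>v\<in>f ` space M. eta (measure M {x\<in>space M. f x = v}))"
  proof (rule sum.cong)
    fix v
    have m: "{x\<in>space M. f x = v} \<in> sets M" by (rule fiber_in_sets[OF f]) simp
    have "measure M {x\<in>space M. f x = v} = measure (distr M M S) {x\<in>space M. f x = v}"
      by (simp add: S(2))
    also have "\<dots> = measure M (S -` {x\<in>space M. f x = v} \<inter> space M)"
      by (rule measure_distr[OF S(1) m])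
    also have "S -` {x\<in>space M. f x = v} \<inter> space M = {x\<in>space M. f (S x) = v}"
      using measurable_space[OF S(1)] by auto
    finally show "eta (measure M {x\<in>space M. f (S x) = v}) = eta (measure M {x\<in>space M. f x = v})"
      by simp
  qed simp
  finally show ?thesis by (simp add: map_entropy_def)
qed

lemma simple_function_comp_endo:
  assumes f: "simple_function M f" and S: "S \<in> M \<rightarrow>\<^sub>M M"
  shows "simple_function M (\<lambda>x. f (S x))"
  using simple_function_comp[OF S f] by (simp add: comp_def)

lemma cond_map_entropy_comp:
  assumes f: "simple_function M f" and q: "simple_function M q"
    and S: "S \<in> M \<rightarrow>\<^sub>M M" "distr M M S = M"
  shows "cond_map_entropy (\<lambda>x. f (S x)) (\<lambda>x. q (S x)) = cond_map_entropy f q"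
proof -
  have fS: "simple_function M (\<lambda>x. f (S x))" and qS: "simple_function M (\<lambda>x. q (S x))"
    and fq: "simple_function M (\<lambda>x. (f x, q x))"
    using f q S simple_function_comp_endo by auto
  show ?thesis
    using map_entropy_Pair_diff[OF f q sets.top] map_entropy_Pair_diff[OF fS qS sets.top]
      map_entropy_comp[OF fq S] map_entropy_comp[OF q S]
    unfolding cond_map_entropy_def by linarith
qed

end

section \<open>Families of maps and Shearer's inequality\<close>

definition joint :: "('i \<Rightarrow> 'a \<Rightarrow> 'v) \<Rightarrow> 'i set \<Rightarrow> 'a \<Rightarrow> 'i \<Rightarrow> 'v" where
  "joint f B x = restrict (\<lambda>i. f i x) B"

text \<open>Outside \<open>B\<close> every coordinate is \<open>undefined\<close> by
  \<open>restrict\<close>, so the fibres are exactly those of the join of the coordinates in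
  \<open>B\<close>.\<close>

lemma joint_eq_iff: "joint f B x = joint f B y \<longleftrightarrow> (\<forall>i\<in>B. f i x = f i y)"
  by (auto simp: joint_def restrict_def fun_eq_iff)

lemma simple_function_joint:
  assumes "finite B" "\<And>i. i \<in> B \<Longrightarrow> simple_function M (f i)"
  shows "simple_function M (joint f B)"
  using assms
proof (induction B)
  case empty
  then show ?case by (simp add: joint_def)
next
  case (insert a B)
  have "simple_function M (\<lambda>x. (f a x, joint f B x))"
    using insert by (intro simple_function_Pair) auto
  then have "simple_function M (\<lambda>x. (\<lambda>(v, w). w(a := v)) (f a x, joint f B x))"
    by (rule simple_function_compose1)
  also have "(\<lambda>x. (\<lambda>(v, w). w(a := v)) (f a x, joint f B x)) = joint f (insert a B)"
    by (auto simp: joint_def restrict_def fun_eq_iff)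
  finally show ?case .
qed

context finite_measure
begin

lemma local_entropy_empty [simp]: "local_entropy {} f = 0"
  by (simp add: local_entropy_def map_entropy_def)

lemma local_entropy_joint_empty [simp]: "local_entropy D (joint f {}) = 0"
proof -
  have "joint f {} = (\<lambda>_ _. undefined)" by (simp add: joint_def fun_eq_iff)
  then show ?thesis
    by (cases "D = {}") (simp_all add: local_entropy_def map_entropy_def image_constant_conv)
qed

lemma map_entropy_joint_insert:
  "map_entropy D (joint f (insert a B)) = map_entropy D (\<lambda>x. (f a x, joint f B x))"
  by (rule map_entropy_kernel_cong) (simp add: joint_eq_iff)

lemma local_entropy_joint_le:
  fixes c :: real
  assumes "finite B" "\<And>i. i \<in> B \<Longrightarrow> simple_function M (f i)" and D: "D \<in> sets M"
    and "\<And>i. i \<in> B \<Longrightarrow> local_entropy D (f i) \<le> c"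
  shows "local_entropy D (joint f B) \<le> card B * c"
  using assms(1,2,4)
proof (induction B)
  case (insert a B)
  have "map_entropy D (joint f (insert a B)) + eta (measure M D)
      \<le> map_entropy D (f a) + map_entropy D (joint f B)"
    unfolding map_entropy_joint_insert using insert
    by (intro map_entropy_subadditive simple_function_joint D) auto
  then have "local_entropy D (joint f (insert a B)) \<le> local_entropy D (f a) + local_entropy D (joint f B)"
    by (simp add: local_entropy_def)
  also have "\<dots> \<le> c + card B * c" using insert by (intro add_mono) auto
  finally show ?case using insert by (simp add: algebra_simps)
qed simp

text \<open>Induction on \<open>F\<close>, adding one index \<open>a\<close>. Its conditional
  entropy given all earlier coordinates is at most its conditional entropy given those in
  \<open>C j\<close> only, so each of the \<open>k\<close> sets \<open>C j\<close> containing
  \<open>a\<close> gains at least as much as \<open>F\<close> does.\<close>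

lemma local_entropy_Shearer:
  assumes "finite F" and J: "finite J" and "\<And>i. i \<in> F \<Longrightarrow> simple_function M (f i)"
    and D: "D \<in> sets M" and "\<And>i. i \<in> F \<Longrightarrow> card {j\<in>J. i \<in> C j} = k"
  shows "k * local_entropy D (joint f F) \<le> (\<Sum>j\<in>J. local_entropy D (joint f (C j \<inter> F)))"
  using assms(1,3,5)
proof (induction F)
  case (insert a F)
  \<comment> \<open>The gain in entropy on \<open>D\<close> when \<open>f a\<close> is adjoined to
    all earlier coordinates.\<close>
  define \<delta> where "\<delta> = local_entropy D (joint f (insert a F)) - local_entropy D (joint f F)"
  have step: "(if a \<in> C j then \<delta> else 0) + local_entropy D (joint f (C j \<inter> F))
      \<le> local_entropy D (joint f (C j \<inter> insert a F))" for j
  proof (cases "a \<in> C j")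
    case True
    have 1: "map_entropy D (\<lambda>x. (f a x, joint f F x, joint f (C j \<inter> F) x))
        = map_entropy D (joint f (insert a F))"
      by (rule map_entropy_kernel_cong) (auto simp: joint_eq_iff)
    have 2: "map_entropy D (\<lambda>x. (joint f F x, joint f (C j \<inter> F) x)) = map_entropy D (joint f F)"
      by (rule map_entropy_kernel_cong) (auto simp: joint_eq_iff)
    have 3: "map_entropy D (\<lambda>x. (f a x, joint f (C j \<inter> F) x)) = map_entropy D (joint f (C j \<inter> insert a F))"
      using True by (simp add: map_entropy_joint_insert[symmetric])
    have "simple_function M (f a)" "simple_function M (joint f F)"
      "simple_function M (joint f (C j \<inter> F))"
      using insert by (auto intro!: simple_function_joint)
    from map_entropy_submodular[OF this D] show ?thesis
      unfolding 1 2 3 using True by (simp add: \<delta>_def local_entropy_def)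
  qed simp
  have "(\<Sum>j\<in>J. if a \<in> C j then \<delta> else 0) = k * \<delta>"
    using insert.prems(2)[of a] J by (simp add: sum.inter_filter[symmetric])
  moreover have "k * local_entropy D (joint f F) \<le> (\<Sum>j\<in>J. local_entropy D (joint f (C j \<inter> F)))"
    using insert by auto
  moreover have "(\<Sum>j\<in>J. (if a \<in> C j then \<delta> else 0) + local_entropy D (joint f (C j \<inter> F)))
      \<le> (\<Sum>j\<in>J. local_entropy D (joint f (C j \<inter> insert a F)))"
    by (intro sum_mono step)
  ultimately show ?case by (simp add: sum.distrib \<delta>_def algebra_simps)
qed simp

end

section \<open>Partitions as fibres of maps\<close>

definition fibers :: "'a set \<Rightarrow> ('a \<Rightarrow> 'v) \<Rightarrow> 'a set set" where
  "fibers X f = (\<lambda>v. {x\<in>X. f x = v}) ` f ` X"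

text \<open>Turns a partition into a map with the cells as values; \<open>fibers_cell\<close>
  recovers the partition from it.\<close>

definition cell :: "'a set set \<Rightarrow> 'a \<Rightarrow> 'a set" where
  "cell P x = (THE A. A \<in> P \<and> x \<in> A)"

lemma cell:
  assumes P: "partition_on X P" and x: "x \<in> X"
  shows "cell P x \<in> P" "x \<in> cell P x" "\<And>A. A \<in> P \<Longrightarrow> x \<in> A \<longleftrightarrow> cell P x = A"
proof -
  have "\<exists>!A. A \<in> P \<and> x \<in> A"
    using P x by (auto simp: partition_on_def disjoint_def)
  from theI'[OF this] show *: "cell P x \<in> P" "x \<in> cell P x" by (auto simp: cell_def)
  show "x \<in> A \<longleftrightarrow> cell P x = A" if "A \<in> P" for A
    using * that P by (auto simp: partition_on_def disjoint_def)
qed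

lemma partition_on_fibers: "partition_on X (fibers X f)"
  by (auto simp: partition_on_def fibers_def disjoint_def)

lemma fibers_cell:
  assumes P: "partition_on X P"
  shows "fibers X (cell P) = P"
proof -
  have *: "{x\<in>X. cell P x = A} = A" if "A \<in> P" for A
    using that P cell[OF P] by (auto simp: partition_on_def)
  have "cell P ` X = P"
  proof
    show "P \<subseteq> cell P ` X"
    proof
      fix A assume A: "A \<in> P"
      then have "A \<noteq> {}" "A \<subseteq> X" using P by (auto simp: partition_on_def)
      then obtain x where "x \<in> A" "x \<in> X" by blast
      then show "A \<in> cell P ` X" using A cell(3)[OF P, of x A] by blast
    qed
  qed (use cell(1)[OF P] in auto)
  then show ?thesis by (simp add: fibers_def * cong: image_cong_simp)
qed

text \<open>A nonempty intersection of chosen cells is determined by any of its points, since every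
  chosen cell must be the one containing that point. Empty intersections are discarded on the left,
  and on the right only attained values are used.\<close>

lemma common_refinement_eq_fibers:
  assumes ne: "\<P> \<noteq> {}" and part: "\<And>P. P \<in> \<P> \<Longrightarrow> partition_on X P"
    and g: "\<And>x y. x \<in> X \<Longrightarrow> y \<in> X \<Longrightarrow> g x = g y \<longleftrightarrow> (\<forall>P\<in>\<P>. cell P x = cell P y)"
  shows "common_refinement \<P> = fibers X g"
proof -
  have Int: "(\<Inter>P\<in>\<P>. cell P x) = {y\<in>X. g y = g x}" if x: "x \<in> X" for x
  proof -
    have sub: "cell P x \<subseteq> X" if "P \<in> \<P>" for P
      using cell(1)[OF part[OF that] x] part[OF that] by (auto simp: partition_on_def)
    have "y \<in> cell P x \<longleftrightarrow> cell P y = cell P x" if "P \<in> \<P>" "y \<in> X" for y P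
      using cell[OF part[OF that(1)]] x that by blast
    then have "y \<in> (\<Inter>P\<in>\<P>. cell P x) \<longleftrightarrow> g y = g x" if "y \<in> X" for y
      using that g[OF that x] by simp
    moreover have "(\<Inter>P\<in>\<P>. cell P x) \<subseteq> X" using sub ne by auto
    ultimately show ?thesis by blast
  qed
  show ?thesis
  proof
    show "common_refinement \<P> \<subseteq> fibers X g"
    proof
      fix Z assume "Z \<in> common_refinement \<P>"
      then obtain f where f: "f \<in> (\<Pi> P\<in>\<P>. P)" "Z = \<Inter> (f ` \<P>)" "Z \<noteq> {}"
        by (auto simp: common_refinement)
      then obtain x where x: "x \<in> Z" by auto
      obtain P0 where P0: "P0 \<in> \<P>" using ne by auto
      have "x \<in> f P0" "f P0 \<in> P0" using f x P0 by auto
      then have X: "x \<in> X" using part[OF P0] by (auto simp: partition_on_def)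
      have "f P = cell P x" if "P \<in> \<P>" for P
        using cell(3)[OF part[OF that] X, of "f P"] f x that by auto
      then have "Z = (\<Inter>P\<in>\<P>. cell P x)" using f by auto
      then show "Z \<in> fibers X g" using X by (auto simp: Int fibers_def)
    qed
    show "fibers X g \<subseteq> common_refinement \<P>"
    proof
      fix Z assume "Z \<in> fibers X g"
      then obtain x where x: "x \<in> X" "Z = {y\<in>X. g y = g x}" by (auto simp: fibers_def)
      have "Z = \<Inter> ((\<lambda>P. cell P x) ` \<P>)" using x Int by simp
      moreover have "(\<lambda>P. cell P x) \<in> (\<Pi> P\<in>\<P>. P)" using cell(1)[OF part] x by auto
      moreover have "Z \<noteq> {}" using x by auto
      ultimately show "Z \<in> common_refinement \<P>" unfolding common_refinement by blast
    qed
  qed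
qed

lemma cell_fibers_eq_iff:
  assumes "x \<in> X" "y \<in> X"
  shows "cell (fibers X f) x = cell (fibers X f) y \<longleftrightarrow> f x = f y"
proof -
  note c = cell[OF partition_on_fibers[of X f]]
  have "{z\<in>X. f z = f x} \<in> fibers X f" using assms by (auto simp: fibers_def)
  then have "cell (fibers X f) x = {z\<in>X. f z = f x}" using c(3)[OF assms(1)] assms by auto
  moreover have "{z\<in>X. f z = f y} \<in> fibers X f" using assms by (auto simp: fibers_def)
  then have "cell (fibers X f) y = {z\<in>X. f z = f y}" using c(3)[OF assms(2)] assms by auto
  ultimately show ?thesis using assms by auto
qed

lemma common_refinement_fibers_Pair:
  "common_refinement {fibers X f, fibers X q} = fibers X (\<lambda>x. (f x, q x))"
  by (rule common_refinement_eq_fibers) (auto simp: partition_on_fibers cell_fibers_eq_iff)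

lemma fibers_finite_partition:
  assumes "simple_function M q"
  shows "fibers (space M) q \<in> finite_partitions M"
proof -
  have "{x\<in>space M. q x = v} = q -` {v} \<inter> space M" for v by auto
  then have "{x\<in>space M. q x = v} \<in> sets M" for v
    using simple_functionD(2)[OF assms, of "{v}"] by simp
  then show ?thesis
    using simple_functionD(1)[OF assms] partition_on_fibers[of "space M" q]
    by (auto simp: finite_partitions_def fibers_def)
qed

lemma simple_function_cell:
  assumes "Q \<in> finite_partitions M"
  shows "simple_function M (cell Q)"
proof -
  from assms have Q: "finite Q" "Q \<subseteq> sets M" "partition_on (space M) Q"
    by (auto simp: finite_partitions_def)
  have img: "cell Q ` space M \<subseteq> Q" using cell(1)[OF Q(3)] by auto
  have "cell Q -` {A} \<inter> space M = A" if A: "A \<in> Q" for A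
  proof -
    have "A \<subseteq> space M" using A Q(2) sets.sets_into_space by blast
    moreover have "x \<in> A \<longleftrightarrow> cell Q x = A" if "x \<in> space M" for x
      by (rule cell(3)[OF Q(3) that A])
    ultimately show ?thesis by blast
  qed
  with img Q(2) have "\<forall>A\<in>cell Q ` space M. cell Q -` {A} \<inter> space M \<in> sets M" by (metis subsetD)
  then show ?thesis
    using finite_subset[OF img Q(1)] by (simp add: simple_function_def)
qed

section \<open>Conditional entropy as an infimum over simple maps\<close>

context finite_measure
begin

lemma part_entropy_fibers: "part_entropy M (fibers (space M) f) = map_entropy (space M) f"
proof -
  have "inj_on (\<lambda>v. {x\<in>space M. f x = v}) (f ` space M)" by (auto simp: inj_on_def)
  then show ?thesis
    by (simp add: part_entropy_def fibers_def sum.reindex map_entropy_def eta_def sum_negf)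
qed

lemma part_entropy_diff_fibers:
  assumes "simple_function M f" "simple_function M q"
  shows "part_entropy M (common_refinement {fibers (space M) f, fibers (space M) q})
    - part_entropy M (fibers (space M) q) = cond_map_entropy f q"
  using map_entropy_Pair_diff[OF assms sets.top]
  by (simp add: common_refinement_fibers_Pair part_entropy_fibers cond_map_entropy_def)

lemma cond_map_entropy_nonneg:
  assumes "simple_function M f" "simple_function M q"
  shows "0 \<le> cond_map_entropy f q"
  unfolding cond_map_entropy_def
  by (intro sum_nonneg local_entropy_nonneg assms fiber_in_sets) auto

lemma simple_function_from_subalgebra:
  "subalgebra M S \<Longrightarrow> simple_function S q \<Longrightarrow> simple_function M q"
  by (auto simp: subalgebra_def simple_function_def)

text \<open>Via \<open>cell\<close> and \<open>fibers\<close>, finite partitions from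
  \<open>S\<close> and \<open>S\<close>-simple maps are interchangeable, so the infimum defining
  conditional entropy lies below every \<open>cond_map_entropy f q\<close> and is approached by such
  values.\<close>

lemma
  assumes S: "subalgebra M S" and f: "simple_function M f"
  shows cond_part_entropy_le:
      "simple_function S q \<Longrightarrow> cond_part_entropy M S (fibers (space M) f) \<le> cond_map_entropy f q"
    and cond_part_entropy_approx:
      "0 < \<epsilon> \<Longrightarrow> \<exists>q :: 'a \<Rightarrow> 'a set. simple_function S q \<and>
        cond_map_entropy f q < cond_part_entropy M S (fibers (space M) f) + \<epsilon>"
proof -
  let ?e = "\<lambda>Q. part_entropy M (common_refinement {fibers (space M) f, Q}) - part_entropy M Q"
  have sp: "space S = space M" using S by (simp add: subalgebra_def)
  have e: "?e Q = cond_map_entropy f (cell Q)" "simple_function S (cell Q)"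
    if Q: "Q \<in> finite_partitions S" for Q
  proof -
    show *: "simple_function S (cell Q)" by (rule simple_function_cell[OF Q])
    have "fibers (space M) (cell Q) = Q"
      using Q by (intro fibers_cell) (simp add: finite_partitions_def sp)
    then show "?e Q = cond_map_entropy f (cell Q)"
      using part_entropy_diff_fibers[OF f simple_function_from_subalgebra[OF S *]] by simp
  qed
  \<comment> \<open>An infimum of reals bounds its set from below only when the set is bounded
    below; nonnegativity of conditional entropy supplies this.\<close>
  have bdd: "bdd_below (?e ` finite_partitions S)"
    using e cond_map_entropy_nonneg[OF f simple_function_from_subalgebra[OF S]]
    by (intro bdd_belowI[of _ 0]) auto
  {
    fix q :: "'a \<Rightarrow> 'w"
    assume q: "simple_function S q"
    have "cond_part_entropy M S (fibers (space M) f) \<le> ?e (fibers (space M) q)"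
      unfolding cond_part_entropy_def
      using fibers_finite_partition[OF q] sp by (intro cINF_lower bdd) simp
    then show "cond_part_entropy M S (fibers (space M) f) \<le> cond_map_entropy f q"
      using part_entropy_diff_fibers[OF f simple_function_from_subalgebra[OF S q]] by simp
  }
  {
    assume "0 < \<epsilon>"
    then have "Inf (?e ` finite_partitions S) < cond_part_entropy M S (fibers (space M) f) + \<epsilon>"
      by (simp add: cond_part_entropy_def)
    \<comment> \<open>The constant map yields the one-cell partition as a witness.\<close>
    moreover have "?e ` finite_partitions S \<noteq> {}"
      using fibers_finite_partition[of S "\<lambda>_. ()"] by auto
    ultimately obtain Q where "Q \<in> finite_partitions S"
      "?e Q < cond_part_entropy M S (fibers (space M) f) + \<epsilon>"
      using cInf_lessD by (metis (no_types, lifting) imageE)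
    then show "\<exists>q :: 'a \<Rightarrow> 'a set. simple_function S q \<and>
        cond_map_entropy f q < cond_part_entropy M S (fibers (space M) f) + \<epsilon>"
      using e by metis
  }
qed

lemma cond_part_entropy_nonneg:
  assumes S: "subalgebra M S" and f: "simple_function M f"
  shows "0 \<le> cond_part_entropy M S (fibers (space M) f)"
proof (rule field_le_epsilon)
  fix \<epsilon> :: real assume "0 < \<epsilon>"
  then obtain q :: "'a \<Rightarrow> 'a set" where "simple_function S q"
    "cond_map_entropy f q < cond_part_entropy M S (fibers (space M) f) + \<epsilon>"
    using cond_part_entropy_approx[OF S f] by blast
  then show "0 \<le> cond_part_entropy M S (fibers (space M) f) + \<epsilon>"
    using cond_map_entropy_nonneg[OF f simple_function_from_subalgebra[OF S]] by force
qed

end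

text \<open>Surjectivity of each \<open>T g\<close> keeps the preimages of cells nonempty, so a
  pulled-back partition is again a partition into fibres; the join then falls under
  \<open>common_refinement_eq_fibers\<close>.\<close>

lemma joined_partition_eq_fibers:
  assumes P: "partition_on (space M) P" and F: "F \<noteq> {}"
    and surj: "\<And>g. g \<in> F \<Longrightarrow> T g ` space M = space M"
  shows "joined_partition M T F P = fibers (space M) (joint (\<lambda>g x. cell P (T g x)) F)"
proof -
  have eq: "pullback_partition M (T g) P = fibers (space M) (\<lambda>x. cell P (T g x))" if g: "g \<in> F" for g
  proof -
    have "(\<lambda>x. cell P (T g x)) ` space M = cell P ` T g ` space M" by (simp add: image_image)
    also have "\<dots> = cell P ` space M" by (simp add: surj[OF g])
    finally have img: "(\<lambda>x. cell P (T g x)) ` space M = cell P ` space M" .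
    have "pullback_partition M (T g) (fibers (space M) (cell P))
        = fibers (space M) (\<lambda>x. cell P (T g x))"
      unfolding pullback_partition_def fibers_def img image_image
      using surj[OF g] by (intro image_cong) auto
    then show ?thesis by (simp add: fibers_cell[OF P])
  qed
  have "joined_partition M T F P = common_refinement ((\<lambda>g. fibers (space M) (\<lambda>x. cell P (T g x))) ` F)"
    unfolding joined_partition_def using eq by (metis (no_types, lifting) image_cong)
  also have "\<dots> = fibers (space M) (joint (\<lambda>g x. cell P (T g x)) F)"
    by (rule common_refinement_eq_fibers)
      (use F in \<open>auto simp: partition_on_fibers cell_fibers_eq_iff joint_eq_iff\<close>)
  finally show ?thesis .
qed

section \<open>Comparing two actions along their common orbits\<close>

text \<open>\<open>D g k\<close> is, up to a null set, the set where \<open>g\<close> and \<open>k\<close> move the point to the same place.\<close>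

locale orbit_coupling = prob_space M
  for M :: "'a measure" +
  fixes S :: "'a measure"
    and G :: "('g, 'r) monoid_scheme" and T :: "'g \<Rightarrow> 'a \<Rightarrow> 'a"
    and \<Gamma> :: "('h, 's) monoid_scheme" and U :: "'h \<Rightarrow> 'a \<Rightarrow> 'a"
    and D :: "'g \<Rightarrow> 'h \<Rightarrow> 'a set" and X\<^sub>0 :: "'a set"
  assumes group_G: "group G" and group_\<Gamma>: "group \<Gamma>"
    and countable_G: "countable (carrier G)" and countable_\<Gamma>: "countable (carrier \<Gamma>)"
    and pmp_T: "pmp_action M G T" and pmp_U: "pmp_action M \<Gamma> U"
    and inv_T: "invariant_subalgebra M G T S" and inv_U: "invariant_subalgebra M \<Gamma> U S"
    and X\<^sub>0: "X\<^sub>0 \<in> sets M" "measure M (space M - X\<^sub>0) = 0"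
    and X\<^sub>0_inv: "x \<in> X\<^sub>0 \<Longrightarrow> g \<in> carrier G \<Longrightarrow> T g x \<in> X\<^sub>0"
    and D: "g \<in> carrier G \<Longrightarrow> k \<in> carrier \<Gamma> \<Longrightarrow> D g k \<in> sets S"
    and D_iff: "x \<in> X\<^sub>0 \<Longrightarrow> g \<in> carrier G \<Longrightarrow> k \<in> carrier \<Gamma> \<Longrightarrow> x \<in> D g k \<longleftrightarrow> T g x = U k x"
    and ex_G: "x \<in> X\<^sub>0 \<Longrightarrow> k \<in> carrier \<Gamma> \<Longrightarrow> \<exists>g\<in>carrier G. T g x = U k x"
    and ex_\<Gamma>: "x \<in> X\<^sub>0 \<Longrightarrow> g \<in> carrier G \<Longrightarrow> \<exists>k\<in>carrier \<Gamma>. T g x = U k x"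
    and free_G: "x \<in> X\<^sub>0 \<Longrightarrow> g \<in> carrier G \<Longrightarrow> h \<in> carrier G \<Longrightarrow> T g x = T h x \<Longrightarrow> g = h"
    and free_\<Gamma>: "x \<in> X\<^sub>0 \<Longrightarrow> k \<in> carrier \<Gamma> \<Longrightarrow> l \<in> carrier \<Gamma> \<Longrightarrow> U k x = U l x \<Longrightarrow> k = l"
begin

section \<open>Consequences of the coupling and finite covers\<close>

sublocale G: group G by (rule group_G)
sublocale \<Gamma>: group \<Gamma> by (rule group_\<Gamma>)
sublocale T: group_action G "space M" T using pmp_T by (simp add: pmp_action_def)
sublocale U: group_action \<Gamma> "space M" U using pmp_U by (simp add: pmp_action_def)

lemma subalgebra_S: "subalgebra M S"
  using inv_T by (simp add: invariant_subalgebra_def)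

lemma space_S: "space S = space M"
  using subalgebra_S by (simp add: subalgebra_def)

lemma sets_S: "A \<in> sets S \<Longrightarrow> A \<in> sets M"
  using subalgebra_S by (auto simp: subalgebra_def)

lemma T_meas [measurable]: "g \<in> carrier G \<Longrightarrow> T g \<in> M \<rightarrow>\<^sub>M M"
  and T_distr: "g \<in> carrier G \<Longrightarrow> distr M M (T g) = M"
  and U_meas [measurable]: "k \<in> carrier \<Gamma> \<Longrightarrow> U k \<in> M \<rightarrow>\<^sub>M M"
  and U_distr: "k \<in> carrier \<Gamma> \<Longrightarrow> distr M M (U k) = M"
  using pmp_T pmp_U by (auto simp: pmp_action_def)

lemma T_meas_S: "g \<in> carrier G \<Longrightarrow> T g \<in> S \<rightarrow>\<^sub>M S"
  and U_meas_S: "k \<in> carrier \<Gamma> \<Longrightarrow> U k \<in> S \<rightarrow>\<^sub>M S"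
  using inv_T inv_U measurable_space[OF T_meas] measurable_space[OF U_meas]
  by (auto simp: measurable_def space_S invariant_subalgebra_def)

lemma T_space [simp]: "g \<in> carrier G \<Longrightarrow> x \<in> space M \<Longrightarrow> T g x \<in> space M"
  and U_space [simp]: "k \<in> carrier \<Gamma> \<Longrightarrow> x \<in> space M \<Longrightarrow> U k x \<in> space M"
  using measurable_space[OF T_meas] measurable_space[OF U_meas] by auto

lemma X\<^sub>0_space: "x \<in> X\<^sub>0 \<Longrightarrow> x \<in> space M"
  using sets.sets_into_space[OF X\<^sub>0(1)] by auto

text \<open>Continuity of the measure from below: finite unions along an enumeration of
  \<open>I\<close> increase to a set containing the conull set \<open>X\<^sub>0\<close>.\<close>

lemma finite_cover:
  assumes I: "countable I" and A: "\<And>i. i \<in> I \<Longrightarrow> A i \<in> sets M"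
    and cover: "X\<^sub>0 \<subseteq> (\<Union>i\<in>I. A i)" and \<delta>: "0 < \<delta>"
  shows "\<exists>W\<subseteq>I. finite W \<and> measure M (space M - (\<Union>i\<in>W. A i)) \<le> \<delta>"
proof (cases "I = {}")
  case True
  then have "X\<^sub>0 = {}" using cover by auto
  then show ?thesis using X\<^sub>0 \<delta> True by auto
next
  case False
  \<comment> \<open>For finite \<open>I\<close> this enumeration repeats elements, which is harmless
    for unions.\<close>
  define e where "e = from_nat_into I"
  have e: "e n \<in> I" for n using False by (simp add: e_def from_nat_into)
  have "(\<lambda>n. measure M (\<Union>i<n. A (e i))) \<longlonglongrightarrow> measure M (\<Union>n. \<Union>i<n. A (e i))"
    by (rule finite_Lim_measure_incseq) (use A e in \<open>auto simp: incseq_def\<close>, force)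
  moreover have "measure M (\<Union>n. \<Union>i<n. A (e i)) = 1"
  proof -
    have "X\<^sub>0 \<subseteq> (\<Union>n. \<Union>i<n. A (e i))"
    proof
      fix x assume "x \<in> X\<^sub>0"
      then obtain i where "i \<in> I" "x \<in> A i" using cover by auto
      moreover obtain n where "i = e n"
        using from_nat_into_surj[OF I \<open>i \<in> I\<close>] by (auto simp: e_def)
      ultimately show "x \<in> (\<Union>n. \<Union>i<n. A (e i))" by (auto intro!: exI[of _ "Suc n"])
    qed
    then have "measure M X\<^sub>0 \<le> measure M (\<Union>n. \<Union>i<n. A (e i))"
      using A e by (intro finite_measure_mono) auto
    moreover have "measure M X\<^sub>0 = 1" using prob_compl[OF X\<^sub>0(1)] X\<^sub>0(2) by simp
    ultimately show ?thesis using prob_le_1[of "\<Union>n. \<Union>i<n. A (e i)"] by simp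
  qed
  ultimately have "\<forall>\<^sub>F n in sequentially. 1 - \<delta> < measure M (\<Union>i<n. A (e i))"
    using \<delta> by (intro order_tendstoD(1)[where y = 1]) auto
  then obtain n where n: "1 - \<delta> < measure M (\<Union>i<n. A (e i))"
    using eventually_happens' trivial_limit_sequentially by blast
  have "(\<Union>i<n. A (e i)) \<in> sets M" using A e by auto
  with prob_compl[OF this] n have "measure M (space M - (\<Union>i\<in>e ` {..<n}. A i)) \<le> \<delta>" by simp
  then show ?thesis using e by (intro exI[of _ "e ` {..<n}"]) auto
qed

text \<open>The union of the finite covers of the single members serves all of them, because
  enlarging a cover only shrinks the uncovered part.\<close>

lemma finite_cover_family:
  assumes K: "finite K" and I: "countable I"
    and A: "\<And>k i. k \<in> K \<Longrightarrow> i \<in> I \<Longrightarrow> A k i \<in> sets M"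
    and cover: "\<And>k. k \<in> K \<Longrightarrow> X\<^sub>0 \<subseteq> (\<Union>i\<in>I. A k i)" and \<delta>: "0 < \<delta>"
  shows "\<exists>W\<subseteq>I. finite W \<and> (\<forall>k\<in>K. measure M (space M - (\<Union>i\<in>W. A k i)) \<le> \<delta>)"
proof -
  have "\<forall>k\<in>K. \<exists>W\<subseteq>I. finite W \<and> measure M (space M - (\<Union>i\<in>W. A k i)) \<le> \<delta>"
    using finite_cover[OF I A cover \<delta>] by auto
  then obtain W where W: "\<And>k. k \<in> K \<Longrightarrow> W k \<subseteq> I" "\<And>k. k \<in> K \<Longrightarrow> finite (W k)"
    "\<And>k. k \<in> K \<Longrightarrow> measure M (space M - (\<Union>i\<in>W k. A k i)) \<le> \<delta>"
    by metis
  have "measure M (space M - (\<Union>i\<in>\<Union>(W ` K). A k i)) \<le> \<delta>" if k: "k \<in> K" for k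
  proof -
    have "(\<Union>i\<in>W k. A k i) \<in> sets M" using W(1,2)[OF k] k A by (intro sets.finite_UN) auto
    then have "measure M (space M - (\<Union>i\<in>\<Union>(W ` K). A k i)) \<le> measure M (space M - (\<Union>i\<in>W k. A k i))"
      using k by (intro finite_measure_mono) auto
    with W(3)[OF k] show ?thesis by simp
  qed
  then show ?thesis using W K by (intro exI[of _ "\<Union>(W ` K)"]) auto
qed

lemma piece_inequality:
  fixes \<pi> :: "'a \<Rightarrow> 'v"
  assumes A: "A \<in> sets M" "A \<subseteq> X\<^sub>0" and F: "finite F" "F \<subseteq> carrier G"
    and E: "finite E" "E \<subseteq> carrier \<Gamma>" "e\<^sub>0 \<in> E"
    and c: "\<And>g. g \<in> F \<Longrightarrow> c g \<in> carrier \<Gamma>"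
      "\<And>g x. g \<in> F \<Longrightarrow> x \<in> A \<Longrightarrow> T g x = U (c g) x"
    and \<pi>: "simple_function M \<pi>" "finite V" "\<pi> ` space M \<subseteq> V"
  shows "card E * local_entropy A (joint (\<lambda>g x. \<pi> (T g x)) F)
    \<le> (\<Sum>g\<in>F. local_entropy A (\<lambda>x. joint (\<lambda>k x. \<pi> (U k x)) E (U (inv\<^bsub>\<Gamma>\<^esub> e\<^sub>0) (T g x))))
      + (\<Sum>e\<in>E. \<Sum>e'\<in>E. card {g\<in>F. e' \<otimes>\<^bsub>\<Gamma>\<^esub> inv\<^bsub>\<Gamma>\<^esub> e \<otimes>\<^bsub>\<Gamma>\<^esub> c g \<notin> c ` F})
        * (card E * (measure M A * ln (card V)))"
    (is "_ \<le> ?R1 + real ?b * _")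
proof (cases "A = {}")
  case True
  then show ?thesis by simp
next
  case False
  then obtain x\<^sub>0 where x\<^sub>0: "x\<^sub>0 \<in> A" by auto
  define B where "B = c ` F"
  define f where "f k x = \<pi> (U k x)" for k x
  define h where "h K = local_entropy A (joint f K)" for K
  define tr where "tr j = (\<lambda>e. e \<otimes>\<^bsub>\<Gamma>\<^esub> j) ` E" for j
  define J where "J = (\<lambda>(e, b). inv\<^bsub>\<Gamma>\<^esub> e \<otimes>\<^bsub>\<Gamma>\<^esub> b) ` (E \<times> B)"
  have B: "finite B" "B \<subseteq> carrier \<Gamma>" using F c by (auto simp: B_def)
  have J: "finite J" "J \<subseteq> carrier \<Gamma>" using B E by (auto simp: J_def)
  have f: "simple_function M (f k)" if "k \<in> carrier \<Gamma>" for k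
    unfolding f_def by (rule simple_function_comp_endo[OF \<pi>(1) U_meas[OF that]])
  \<comment> \<open>Equal values of \<open>c\<close> would send \<open>x\<^sub>0\<close> to the same
    point under two elements of \<open>G\<close>, against freeness.\<close>
  have c_inj: "inj_on c F"
    using c F x\<^sub>0 free_G A by (intro inj_onI) (metis subsetD)
  have tr_sub: "tr j \<subseteq> carrier \<Gamma>" if "j \<in> carrier \<Gamma>" for j using that E by (auto simp: tr_def)
  have tr_fin: "finite (tr j)" for j using E by (simp add: tr_def)
  have h_nonneg: "0 \<le> h K" if "finite K" "K \<subseteq> carrier \<Gamma>" for K
    unfolding h_def using that f by (intro local_entropy_nonneg simple_function_joint A) auto
  define C where "C = measure M A * ln (card V)"
  have "V \<noteq> {}" using \<pi>(3) x\<^sub>0 sets.sets_into_space[OF A(1)] by auto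
  then have C: "0 \<le> C" using \<pi>(2) by (simp add: C_def card_gt_0_iff Suc_le_eq)
  have h_le: "h K \<le> card K * C" if "finite K" "K \<subseteq> carrier \<Gamma>" for K
    unfolding h_def C_def
  proof (rule local_entropy_joint_le[OF that(1) _ A(1)])
    fix k assume "k \<in> K"
    then have k: "k \<in> carrier \<Gamma>" using that by auto
    then show "local_entropy A (f k) \<le> measure M A * ln (card V)"
      using \<pi> sets.sets_into_space[OF A(1)]
      by (intro local_entropy_le_ln_card f A) (auto simp: f_def subset_eq)
  qed (use f that in auto)
  \<comment> \<open>\<open>b\<close> lies in the translate by \<open>j\<close> exactly when
    \<open>j\<close> is the product of the inverse of some \<open>e\<close> in \<open>E\<close> with
    \<open>b\<close>. Distinct \<open>e\<close> give distinct \<open>j\<close>, and \<open>J\<close>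
    was defined to contain them all.\<close>
  have "card {j\<in>J. b \<in> tr j} = card E" if b: "b \<in> B" for b
  proof -
    have "{j\<in>J. b \<in> tr j} = (\<lambda>e. inv\<^bsub>\<Gamma>\<^esub> e \<otimes>\<^bsub>\<Gamma>\<^esub> b) ` E"
    proof (rule equalityI; rule subsetI)
      fix j assume "j \<in> {j\<in>J. b \<in> tr j}"
      then obtain e where e: "e \<in> E" "b = e \<otimes>\<^bsub>\<Gamma>\<^esub> j" "j \<in> carrier \<Gamma>" using J by (auto simp: tr_def)
      then have "j = inv\<^bsub>\<Gamma>\<^esub> e \<otimes>\<^bsub>\<Gamma>\<^esub> b" using E by (auto simp: \<Gamma>.inv_solve_left)
      then show "j \<in> (\<lambda>e. inv\<^bsub>\<Gamma>\<^esub> e \<otimes>\<^bsub>\<Gamma>\<^esub> b) ` E" using e by auto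
    next
      fix j assume "j \<in> (\<lambda>e. inv\<^bsub>\<Gamma>\<^esub> e \<otimes>\<^bsub>\<Gamma>\<^esub> b) ` E"
      then obtain e where e: "e \<in> E" "j = inv\<^bsub>\<Gamma>\<^esub> e \<otimes>\<^bsub>\<Gamma>\<^esub> b" by auto
      have "e \<in> carrier \<Gamma>" "b \<in> carrier \<Gamma>" using e E b B by auto
      then have "b = e \<otimes>\<^bsub>\<Gamma>\<^esub> j" using e by (simp add: \<Gamma>.m_assoc[symmetric])
      then show "j \<in> {j\<in>J. b \<in> tr j}" using e b by (auto simp: J_def tr_def)
    qed
    moreover have "inj_on (\<lambda>e. inv\<^bsub>\<Gamma>\<^esub> e \<otimes>\<^bsub>\<Gamma>\<^esub> b) E"
    proof (rule inj_onI)
      fix e e' assume ee: "e \<in> E" "e' \<in> E" "inv\<^bsub>\<Gamma>\<^esub> e \<otimes>\<^bsub>\<Gamma>\<^esub> b = inv\<^bsub>\<Gamma>\<^esub> e' \<otimes>\<^bsub>\<Gamma>\<^esub> b"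
      then have "e \<in> carrier \<Gamma>" "e' \<in> carrier \<Gamma>" "b \<in> carrier \<Gamma>" using E b B by auto
      with ee show "e = e'" using \<Gamma>.inv_inj by (auto simp: inj_on_def)
    qed
    ultimately show ?thesis by (simp add: card_image)
  qed
  then have "card E * h B \<le> (\<Sum>j\<in>J. h (tr j \<inter> B))"
    unfolding h_def using B f by (intro local_entropy_Shearer J A) auto
  also have "\<dots> = (\<Sum>j\<in>{j\<in>J. tr j \<subseteq> B}. h (tr j \<inter> B)) + (\<Sum>j\<in>{j\<in>J. \<not> tr j \<subseteq> B}. h (tr j \<inter> B))"
    using J by (subst sum.union_disjoint[symmetric]) (auto intro!: sum.cong)
  \<comment> \<open>If the whole translate lies in \<open>B\<close>, so does its point
    \<open>e\<^sub>0 \<otimes> j\<close>; hence there is at most one such \<open>j\<close> for each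
    element of \<open>B\<close>. Missing indices may be added since entropies are
    nonnegative.\<close>
  also have "(\<Sum>j\<in>{j\<in>J. tr j \<subseteq> B}. h (tr j \<inter> B)) \<le> ?R1"
  proof -
    have inj: "inj_on (\<lambda>b. inv\<^bsub>\<Gamma>\<^esub> e\<^sub>0 \<otimes>\<^bsub>\<Gamma>\<^esub> b) B"
      using B E by (intro inj_onI) (auto simp: subset_eq)
    have sub: "{j\<in>J. tr j \<subseteq> B} \<subseteq> (\<lambda>b. inv\<^bsub>\<Gamma>\<^esub> e\<^sub>0 \<otimes>\<^bsub>\<Gamma>\<^esub> b) ` B"
    proof
      fix j assume "j \<in> {j\<in>J. tr j \<subseteq> B}"
      then have j: "j \<in> carrier \<Gamma>" "e\<^sub>0 \<otimes>\<^bsub>\<Gamma>\<^esub> j \<in> B" using J E by (auto simp: tr_def)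
      moreover have "j = inv\<^bsub>\<Gamma>\<^esub> e\<^sub>0 \<otimes>\<^bsub>\<Gamma>\<^esub> (e\<^sub>0 \<otimes>\<^bsub>\<Gamma>\<^esub> j)"
        using j E by (auto simp: \<Gamma>.m_assoc[symmetric])
      ultimately show "j \<in> (\<lambda>b. inv\<^bsub>\<Gamma>\<^esub> e\<^sub>0 \<otimes>\<^bsub>\<Gamma>\<^esub> b) ` B" by blast
    qed
    have e0: "inv\<^bsub>\<Gamma>\<^esub> e\<^sub>0 \<in> carrier \<Gamma>" using E by auto
    have "(\<Sum>j\<in>{j\<in>J. tr j \<subseteq> B}. h (tr j \<inter> B)) = (\<Sum>j\<in>{j\<in>J. tr j \<subseteq> B}. h (tr j))"
      by (intro sum.cong) (auto simp: Int_absorb2)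
    also have "\<dots> \<le> (\<Sum>j\<in>(\<lambda>b. inv\<^bsub>\<Gamma>\<^esub> e\<^sub>0 \<otimes>\<^bsub>\<Gamma>\<^esub> b) ` B. h (tr j))"
      using B e0 by (intro sum_mono2 sub h_nonneg tr_fin tr_sub) auto
    also have "\<dots> = (\<Sum>g\<in>F. h (tr (inv\<^bsub>\<Gamma>\<^esub> e\<^sub>0 \<otimes>\<^bsub>\<Gamma>\<^esub> c g)))"
      by (simp add: sum.reindex[OF inj]) (simp add: B_def sum.reindex[OF c_inj])
    also have "\<dots> = ?R1"
    proof (rule sum.cong)
      fix g assume g: "g \<in> F"
      show "h (tr (inv\<^bsub>\<Gamma>\<^esub> e\<^sub>0 \<otimes>\<^bsub>\<Gamma>\<^esub> c g))
          = local_entropy A (\<lambda>x. joint (\<lambda>k x. \<pi> (U k x)) E (U (inv\<^bsub>\<Gamma>\<^esub> e\<^sub>0) (T g x)))"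
        unfolding h_def
      proof (rule local_entropy_kernel_cong)
        have "f (e \<otimes>\<^bsub>\<Gamma>\<^esub> (inv\<^bsub>\<Gamma>\<^esub> e\<^sub>0 \<otimes>\<^bsub>\<Gamma>\<^esub> c g)) x = \<pi> (U e (U (inv\<^bsub>\<Gamma>\<^esub> e\<^sub>0) (T g x)))"
          if "e \<in> E" "x \<in> A" for e x
        proof -
          have "x \<in> space M" using that A X\<^sub>0_space by auto
          moreover have "e \<in> carrier \<Gamma>" using that E by auto
          ultimately show ?thesis
            using c[OF g] that e0 by (simp add: f_def U.composition_rule)
        qed
        then show "joint f (tr (inv\<^bsub>\<Gamma>\<^esub> e\<^sub>0 \<otimes>\<^bsub>\<Gamma>\<^esub> c g)) x = joint f (tr (inv\<^bsub>\<Gamma>\<^esub> e\<^sub>0 \<otimes>\<^bsub>\<Gamma>\<^esub> c g)) y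
          \<longleftrightarrow> joint (\<lambda>k x. \<pi> (U k x)) E (U (inv\<^bsub>\<Gamma>\<^esub> e\<^sub>0) (T g x))
            = joint (\<lambda>k x. \<pi> (U k x)) E (U (inv\<^bsub>\<Gamma>\<^esub> e\<^sub>0) (T g y))"
          if "x \<in> A" "y \<in> A" for x y
          using that by (simp add: joint_eq_iff tr_def)
      qed
    qed simp
    finally show ?thesis .
  qed
  also have "(\<Sum>j\<in>{j\<in>J. \<not> tr j \<subseteq> B}. h (tr j \<inter> B)) \<le> ?b * (card E * C)"
  proof -
    have "(\<Sum>j\<in>{j\<in>J. \<not> tr j \<subseteq> B}. h (tr j \<inter> B)) \<le> (\<Sum>j\<in>{j\<in>J. \<not> tr j \<subseteq> B}. card E * C)"
    proof (rule sum_mono)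
      fix j assume "j \<in> {j\<in>J. \<not> tr j \<subseteq> B}"
      then have j: "j \<in> carrier \<Gamma>" using J by auto
      have "card (tr j \<inter> B) \<le> card (tr j)" by (intro card_mono tr_fin) auto
      also have "\<dots> \<le> card E" unfolding tr_def by (rule card_image_le[OF E(1)])
      finally have "card (tr j \<inter> B) * C \<le> card E * C" using C by (intro mult_right_mono) auto
      moreover have "h (tr j \<inter> B) \<le> card (tr j \<inter> B) * C" using B by (intro h_le) auto
      ultimately show "h (tr j \<inter> B) \<le> card E * C" by linarith
    qed
    also have "\<dots> = card {j\<in>J. \<not> tr j \<subseteq> B} * (card E * C)" by simp
    also have "\<dots> \<le> ?b * (card E * C)"
    proof -
      \<comment> \<open>An escaping \<open>j\<close> meets \<open>B\<close> at \<open>c g\<close>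
        through some \<open>e\<close> and leaves it through some \<open>e'\<close>; each triple of
        \<open>e\<close>, \<open>e'\<close>, \<open>g\<close> determines at most one such
        \<open>j\<close>.\<close>
      have sub: "{j\<in>J. \<not> tr j \<subseteq> B} \<subseteq> (\<Union>e\<in>E. \<Union>e'\<in>E.
        (\<lambda>g. inv\<^bsub>\<Gamma>\<^esub> e \<otimes>\<^bsub>\<Gamma>\<^esub> c g) ` {g\<in>F. e' \<otimes>\<^bsub>\<Gamma>\<^esub> inv\<^bsub>\<Gamma>\<^esub> e \<otimes>\<^bsub>\<Gamma>\<^esub> c g \<notin> c ` F})"
      proof
        fix j assume "j \<in> {j\<in>J. \<not> tr j \<subseteq> B}"
        then obtain e e' g where *: "e \<in> E" "e' \<in> E" "g \<in> F" "j = inv\<^bsub>\<Gamma>\<^esub> e \<otimes>\<^bsub>\<Gamma>\<^esub> c g" "e' \<otimes>\<^bsub>\<Gamma>\<^esub> j \<notin> c ` F"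
          by (auto simp: J_def B_def tr_def)
        moreover have "e \<in> carrier \<Gamma>" "e' \<in> carrier \<Gamma>" using * E by auto
        ultimately have "e' \<otimes>\<^bsub>\<Gamma>\<^esub> inv\<^bsub>\<Gamma>\<^esub> e \<otimes>\<^bsub>\<Gamma>\<^esub> c g \<notin> c ` F" using c by (simp add: \<Gamma>.m_assoc)
        with * show "j \<in> (\<Union>e\<in>E. \<Union>e'\<in>E.
          (\<lambda>g. inv\<^bsub>\<Gamma>\<^esub> e \<otimes>\<^bsub>\<Gamma>\<^esub> c g) ` {g\<in>F. e' \<otimes>\<^bsub>\<Gamma>\<^esub> inv\<^bsub>\<Gamma>\<^esub> e \<otimes>\<^bsub>\<Gamma>\<^esub> c g \<notin> c ` F})" by blast
      qed
      have "card {j\<in>J. \<not> tr j \<subseteq> B} \<le> card (\<Union>e\<in>E. \<Union>e'\<in>E.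
        (\<lambda>g. inv\<^bsub>\<Gamma>\<^esub> e \<otimes>\<^bsub>\<Gamma>\<^esub> c g) ` {g\<in>F. e' \<otimes>\<^bsub>\<Gamma>\<^esub> inv\<^bsub>\<Gamma>\<^esub> e \<otimes>\<^bsub>\<Gamma>\<^esub> c g \<notin> c ` F})"
        using E F by (intro card_mono sub) auto
      also have "\<dots> \<le> (\<Sum>e\<in>E. card (\<Union>e'\<in>E.
        (\<lambda>g. inv\<^bsub>\<Gamma>\<^esub> e \<otimes>\<^bsub>\<Gamma>\<^esub> c g) ` {g\<in>F. e' \<otimes>\<^bsub>\<Gamma>\<^esub> inv\<^bsub>\<Gamma>\<^esub> e \<otimes>\<^bsub>\<Gamma>\<^esub> c g \<notin> c ` F}))"
        by (rule card_UN_le[OF E(1)])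
      also have "\<dots> \<le> (\<Sum>e\<in>E. \<Sum>e'\<in>E. card (
        (\<lambda>g. inv\<^bsub>\<Gamma>\<^esub> e \<otimes>\<^bsub>\<Gamma>\<^esub> c g) ` {g\<in>F. e' \<otimes>\<^bsub>\<Gamma>\<^esub> inv\<^bsub>\<Gamma>\<^esub> e \<otimes>\<^bsub>\<Gamma>\<^esub> c g \<notin> c ` F}))"
        by (intro sum_mono card_UN_le[OF E(1)])
      also have "\<dots> \<le> ?b"
        using F by (intro sum_mono card_image_le) auto
      finally show ?thesis using C by (intro mult_right_mono of_nat_mono) auto
    qed
    finally show ?thesis .
  qed
  finally have "card E * h B \<le> ?R1 + ?b * (card E * C)" by simp
  moreover have "h B = local_entropy A (joint (\<lambda>g x. \<pi> (T g x)) F)"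
    unfolding h_def B_def using c
    by (intro local_entropy_kernel_cong) (simp add: joint_eq_iff f_def)
  ultimately show ?thesis by (simp add: C_def)
qed


text \<open>For most points, an element of \<open>L\<close> realises each move by
  \<open>e' \<otimes> inv e\<close>, so near invariance of \<open>F\<close> under \<open>L\<close>
  carries over to the random set of cocycle values. \<open>piece_inequality\<close> is summed over
  the fibres of a finite \<open>S\<close>-measurable map. The three error terms come, in order, from
  a nearly optimal conditioning map, from the boundary, and from fibres where the cocycle is not
  controlled.\<close>

lemma finite_set_inequality:
  fixes \<pi> :: "'a \<Rightarrow> 'v" and \<delta> :: real
  assumes F: "finite F" "F \<subseteq> carrier G"
    and E: "finite E" "E \<subseteq> carrier \<Gamma>" "E \<noteq> {}"
    and L: "L \<subseteq> carrier G"
      "\<And>e e'. e \<in> E \<Longrightarrow> e' \<in> E \<Longrightarrow>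
        measure M (space M - (\<Union>l\<in>L. D l (e' \<otimes>\<^bsub>\<Gamma>\<^esub> inv\<^bsub>\<Gamma>\<^esub> e))) \<le> \<delta>"
      "finite L"
    and folner: "card {g\<in>F. \<exists>l\<in>L. l \<otimes>\<^bsub>G\<^esub> g \<notin> F} \<le> \<delta> * card F"
    and \<delta>: "0 < \<delta>"
    and \<pi>: "simple_function M \<pi>" "finite V" "\<pi> ` space M \<subseteq> V"
  shows "card E * cond_part_entropy M S (fibers (space M) (joint (\<lambda>g x. \<pi> (T g x)) F))
    \<le> card F * (cond_part_entropy M S (fibers (space M) (joint (\<lambda>k x. \<pi> (U k x)) E))
        + \<delta> * (1 + 2 * (card E) ^ 3 * ln (card V) + card E * ln (card V)))"
proof (cases "F = {}")
  case True
  have "cond_part_entropy M S (fibers (space M) (joint (\<lambda>g x. \<pi> (T g x)) {}))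
      \<le> cond_map_entropy (joint (\<lambda>g x. \<pi> (T g x)) {}) (\<lambda>_. ())"
    by (intro cond_part_entropy_le subalgebra_S simple_function_joint) auto
  also have "\<dots> = 0" by (simp add: cond_map_entropy_def)
  finally show ?thesis using True by (simp add: mult_nonneg_nonpos)
next
  case F_ne: False
  obtain e\<^sub>0 where e\<^sub>0: "e\<^sub>0 \<in> E" using E by auto
  have e\<^sub>0_inv: "inv\<^bsub>\<Gamma>\<^esub> e\<^sub>0 \<in> carrier \<Gamma>" using E e\<^sub>0 by auto
  define f where "f = joint (\<lambda>g x. \<pi> (T g x)) F"
  define r where "r = joint (\<lambda>k x. \<pi> (U k x)) E"
  define C where "C = ln (card V)"
  have V: "V \<noteq> {}" using \<pi>(3) not_empty by auto
  then have C: "0 \<le> C" using \<pi>(2) by (simp add: C_def card_gt_0_iff Suc_le_eq)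
  have f: "simple_function M f"
    unfolding f_def using F simple_function_comp_endo[OF \<pi>(1) T_meas]
    by (intro simple_function_joint) auto
  have r: "simple_function M r"
    unfolding r_def using E simple_function_comp_endo[OF \<pi>(1) U_meas]
    by (intro simple_function_joint) auto
  obtain q\<^sub>0 :: "'a \<Rightarrow> 'a set" where q\<^sub>0: "simple_function S q\<^sub>0"
    and q\<^sub>0_le: "cond_map_entropy r q\<^sub>0 < cond_part_entropy M S (fibers (space M) r) + \<delta>"
    using cond_part_entropy_approx[OF subalgebra_S r \<delta>] by blast
  have q\<^sub>0_M: "simple_function M q\<^sub>0" by (rule simple_function_from_subalgebra[OF subalgebra_S q\<^sub>0])
  \<comment> \<open>Finitely many elements of \<Gamma> capture the cocycle for each \<open>g\<close>
    in \<open>F\<close>; the tolerance is divided by \<open>card F\<close> so that the exceptional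
    sets together have measure at most \<delta>.\<close>
  obtain W where W: "W \<subseteq> carrier \<Gamma>" "finite W"
    "\<And>g. g \<in> F \<Longrightarrow> measure M (space M - (\<Union>k\<in>W. D g k)) \<le> \<delta> / card F"
  proof -
    have "\<exists>W\<subseteq>carrier \<Gamma>. finite W \<and> (\<forall>g\<in>F. measure M (space M - (\<Union>k\<in>W. D g k)) \<le> \<delta> / card F)"
    proof (rule finite_cover_family[OF F(1) countable_\<Gamma>])
      show "X\<^sub>0 \<subseteq> (\<Union>k\<in>carrier \<Gamma>. D g k)" if "g \<in> F" for g
        using that F ex_\<Gamma> D_iff by (auto simp: subset_eq)
      show "0 < \<delta> / card F" using \<delta> F F_ne by (simp add: card_gt_0_iff)
    qed (use F D sets_S in auto)
    with that show thesis by blast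
  qed
  have D_M: "D g k \<in> sets M" if "g \<in> F" "k \<in> W" for g k
    using D[of g k] F W(1) sets_S that by blast
  \<comment> \<open>Where the cocycle at \<open>g\<close> equals \<open>c g\<close>, this is the
    base point from which \<open>E\<close> sees the translate of \<open>E\<close> that places
    \<open>e\<^sub>0\<close> on \<open>c g\<close>.\<close>
  define \<sigma> where "\<sigma> g x = U (inv\<^bsub>\<Gamma>\<^esub> e\<^sub>0) (T g x)" for g x
  have \<sigma>: "\<sigma> g \<in> M \<rightarrow>\<^sub>M M" "distr M M (\<sigma> g) = M" "\<sigma> g \<in> S \<rightarrow>\<^sub>M S" if "g \<in> carrier G" for g
  proof -
    have *: "\<sigma> g = U (inv\<^bsub>\<Gamma>\<^esub> e\<^sub>0) \<circ> T g" by (auto simp: \<sigma>_def)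
    show "\<sigma> g \<in> M \<rightarrow>\<^sub>M M" "\<sigma> g \<in> S \<rightarrow>\<^sub>M S"
      unfolding * using measurable_comp[OF T_meas[OF that] U_meas[OF e\<^sub>0_inv]]
        measurable_comp[OF T_meas_S[OF that] U_meas_S[OF e\<^sub>0_inv]] by auto
    have "distr M M (\<sigma> g) = distr (distr M M (T g)) M (U (inv\<^bsub>\<Gamma>\<^esub> e\<^sub>0))"
      unfolding * using that e\<^sub>0_inv by (intro distr_distr[symmetric] U_meas T_meas)
    then show "distr M M (\<sigma> g) = M" using that e\<^sub>0_inv by (simp add: T_distr U_distr)
  qed
  txt \<open>The first component of \<open>q\<close> makes the cocycle constant on \<open>F\<close> along good fibres; the second makes
    \<open>q\<close> refine all \<open>q\<^sub>0 \<circ> \<sigma> g\<close>, so that invariance carries the choice of \<open>q\<^sub>0\<close> to every translate of \<open>E\<close>.\<close>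
  define q where "q x = (joint (\<lambda>(g, k) x. x \<in> D g k) (F \<times> W) x, joint (\<lambda>g x. q\<^sub>0 (\<sigma> g x)) F x)" for x
  have q: "simple_function S q"
    unfolding q_def
  proof (intro simple_function_Pair simple_function_joint)
    show "simple_function S ((\<lambda>(g, k) x. x \<in> D g k) i)" if i: "i \<in> F \<times> W" for i
    proof -
      obtain g k where gk: "i = (g, k)" "g \<in> F" "k \<in> W" using i by auto
      then have "D g k \<in> sets S" using D F W by auto
      then have "Measurable.pred S (\<lambda>x. x \<in> D g k)" by measurable
      then have "simple_function S (\<lambda>x. x \<in> D g k)"
        unfolding simple_function_def by (auto intro: finite_subset[of _ UNIV])
      then show ?thesis using gk by simp
    qed
    show "simple_function S (\<lambda>x. q\<^sub>0 (\<sigma> g x))" if "g \<in> F" for g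
      using simple_function_comp[OF \<sigma>(3) q\<^sub>0] that F by (auto simp: comp_def)
  qed (use F W in auto)
  have q_M: "simple_function M q" by (rule simple_function_from_subalgebra[OF subalgebra_S q])
  define fib where "fib w = {x\<in>space M. q x = w}" for w
  define Q where "Q = q ` space M"
  have Q: "finite Q" unfolding Q_def by (rule simple_functionD(1)[OF q_M])
  have fib: "fib w \<in> sets M" for w unfolding fib_def by (rule fiber_in_sets[OF q_M sets.top])
  have fib_disj: "disjoint_family_on fib A" for A by (auto simp: disjoint_family_on_def fib_def)
  have sum_fib: "(\<Sum>w\<in>A. measure M (fib w)) = measure M (\<Union>w\<in>A. fib w)" if "A \<subseteq> Q" for A
    using fib that Q finite_subset by (intro finite_measure_finite_Union[symmetric] fib_disj) auto
  \<comment> \<open>The label \<open>w\<close> itself records which sets \<open>D g k\<close>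
    contain its fibre, so \<open>good\<close> and the value \<open>c w g\<close> are read off from
    \<open>w\<close> alone.\<close>
  define good where "good w \<longleftrightarrow> (\<forall>g\<in>F. \<exists>k\<in>W. fst w (g, k))" for w :: "(('g \<times> 'h) \<Rightarrow> bool) \<times> ('g \<Rightarrow> 'a set)"
  define c where "c w g = (SOME k. k \<in> W \<and> fst w (g, k))" for w :: "(('g \<times> 'h) \<Rightarrow> bool) \<times> ('g \<Rightarrow> 'a set)" and g
  have c: "c w g \<in> W" "fst w (g, c w g)" if "good w" "g \<in> F" for w g
    using that someI_ex[of "\<lambda>k. k \<in> W \<and> fst w (g, k)"] unfolding good_def c_def by blast+
  have c_\<Gamma>: "c w g \<in> carrier \<Gamma>" if "good w" "g \<in> F" for w g using c W that by blast
  have c_T: "T g x = U (c w g) x" if "good w" "g \<in> F" "x \<in> fib w \<inter> X\<^sub>0" for w g x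
  proof -
    have "fst (q x) (g, c w g)" using c that by (simp add: fib_def)
    then have "x \<in> D g (c w g)" using c that by (simp add: q_def joint_def)
    then show ?thesis using D_iff[of x g "c w g"] that c_\<Gamma> F by auto
  qed
  \<comment> \<open>All points of a bad fibre are left uncovered by \<open>W\<close> for one and the
    same \<open>g\<close> in \<open>F\<close>.\<close>
  have bad: "(\<Sum>w\<in>{w\<in>Q. \<not> good w}. measure M (fib w)) \<le> \<delta>"
  proof -
    have "(\<Union>w\<in>{w\<in>Q. \<not> good w}. fib w) \<subseteq> (\<Union>g\<in>F. space M - (\<Union>k\<in>W. D g k))"
      by (auto simp: fib_def good_def q_def joint_def)
    moreover have UW: "(\<Union>k\<in>W. D g k) \<in> sets M" if "g \<in> F" for g
      using that D_M W(2) by (intro sets.finite_UN) auto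
    ultimately have "measure M (\<Union>w\<in>{w\<in>Q. \<not> good w}. fib w)
        \<le> measure M (\<Union>g\<in>F. space M - (\<Union>k\<in>W. D g k))"
      using F by (intro finite_measure_mono sets.finite_UN) auto
    also have "\<dots> \<le> (\<Sum>g\<in>F. measure M (space M - (\<Union>k\<in>W. D g k)))"
      using F UW by (intro finite_measure_subadditive_finite) (auto simp del: UN_simps)
    also have "\<dots> \<le> (\<Sum>g\<in>F. \<delta> / card F)" by (intro sum_mono W)
    also have "\<dots> = \<delta>" using F F_ne by simp
    finally show ?thesis by (subst sum_fib) auto
  qed
  define bd where "bd w g e e' \<longleftrightarrow> e' \<otimes>\<^bsub>\<Gamma>\<^esub> inv\<^bsub>\<Gamma>\<^esub> e \<otimes>\<^bsub>\<Gamma>\<^esub> c w g \<notin> c w ` F" for w g e e'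
  \<comment> \<open>If some translate of \<open>g\<close> by \<open>L\<close> leaves
    \<open>F\<close>, the trivial bound 1 is used. Otherwise a boundary event at \<open>x\<close>
    forces \<open>T g x\<close> out of all \<open>D l k\<close> with \<open>l\<close> in
    \<open>L\<close>, and since \<open>T g\<close> preserves the measure this has probability at
    most \<delta>.\<close>
  have boundary: "(\<Sum>w\<in>{w\<in>Q. good w \<and> bd w g e e'}. measure M (fib w))
      \<le> \<delta> + (if \<exists>l\<in>L. l \<otimes>\<^bsub>G\<^esub> g \<notin> F then 1 else 0)"
    if g: "g \<in> F" and e: "e \<in> E" "e' \<in> E" for g e e'
  proof (cases "\<exists>l\<in>L. l \<otimes>\<^bsub>G\<^esub> g \<notin> F")
    case True
    have "(\<Sum>w\<in>{w\<in>Q. good w \<and> bd w g e e'}. measure M (fib w)) \<le> 1"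
      by (subst sum_fib) auto
    then show ?thesis using True \<delta> by simp
  next
    case False
    define k where "k = e' \<otimes>\<^bsub>\<Gamma>\<^esub> inv\<^bsub>\<Gamma>\<^esub> e"
    have k: "k \<in> carrier \<Gamma>" using e E by (auto simp: k_def)
    have gG: "g \<in> carrier G" using g F by auto
    have meas: "space M - (\<Union>l\<in>L. D l k) \<in> sets M"
      using L D k sets_S by (intro sets.Diff sets.finite_UN) auto
    have "(\<Union>w\<in>{w\<in>Q. good w \<and> bd w g e e'}. fib w) \<inter> X\<^sub>0
        \<subseteq> T g -` (space M - (\<Union>l\<in>L. D l k)) \<inter> space M"
    proof
      fix x assume "x \<in> (\<Union>w\<in>{w\<in>Q. good w \<and> bd w g e e'}. fib w) \<inter> X\<^sub>0"
      then obtain w where w: "good w" "bd w g e e'" "x \<in> fib w \<inter> X\<^sub>0" by auto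
      have x: "x \<in> X\<^sub>0" "x \<in> space M" using w X\<^sub>0_space by auto
      have "T g x \<notin> D l k" if l: "l \<in> L" for l
      proof
        assume "T g x \<in> D l k"
        have lG: "l \<in> carrier G" using l L by auto
        have lg: "l \<otimes>\<^bsub>G\<^esub> g \<in> F" using False l by auto
        have "T l (T g x) = U k (T g x)"
          using \<open>T g x \<in> D l k\<close> D_iff[OF X\<^sub>0_inv[OF x(1) gG] lG k] by simp
        then have "T (l \<otimes>\<^bsub>G\<^esub> g) x = U k (T g x)"
          using lG gG x by (simp add: T.composition_rule)
        also have "\<dots> = U (k \<otimes>\<^bsub>\<Gamma>\<^esub> c w g) x"
          using k c_\<Gamma>[OF w(1) g] x c_T[OF w(1) g w(3)] by (simp add: U.composition_rule)
        finally have "U (c w (l \<otimes>\<^bsub>G\<^esub> g)) x = U (k \<otimes>\<^bsub>\<Gamma>\<^esub> c w g) x"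
          using c_T[OF w(1) lg w(3)] by simp
        \<comment> \<open>The cocycle identity, extracted by freeness of \<Gamma>: it puts
          \<open>k \<otimes> c w g\<close> back into the image of \<open>F\<close>, contradicting
          \<open>bd\<close>.\<close>
        then have "c w (l \<otimes>\<^bsub>G\<^esub> g) = k \<otimes>\<^bsub>\<Gamma>\<^esub> c w g"
          using free_\<Gamma> x k c_\<Gamma>[OF w(1)] g lg by simp
        then show False using w(2) lg unfolding bd_def k_def by (metis imageI)
      qed
      then show "x \<in> T g -` (space M - (\<Union>l\<in>L. D l k)) \<inter> space M" using x gG by auto
    qed
    then have "measure M ((\<Union>w\<in>{w\<in>Q. good w \<and> bd w g e e'}. fib w) \<inter> X\<^sub>0)
        \<le> measure M (T g -` (space M - (\<Union>l\<in>L. D l k)) \<inter> space M)"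
      using meas gG by (intro finite_measure_mono) auto
    also have "\<dots> = measure (distr M M (T g)) (space M - (\<Union>l\<in>L. D l k))"
      by (rule measure_distr[OF T_meas[OF gG] meas, symmetric])
    also have "\<dots> \<le> \<delta>" using L(2)[OF e] gG by (simp add: T_distr k_def)
    finally have "measure M ((\<Union>w\<in>{w\<in>Q. good w \<and> bd w g e e'}. fib w) \<inter> X\<^sub>0) \<le> \<delta>" .
    moreover have "(\<Union>w\<in>{w\<in>Q. good w \<and> bd w g e e'}. fib w) \<in> sets M"
      using fib Q by (intro sets.finite_UN) auto
    ultimately have "measure M (\<Union>w\<in>{w\<in>Q. good w \<and> bd w g e e'}. fib w) \<le> \<delta>"
      using measure_Int_conull X\<^sub>0 by simp
    then show ?thesis using \<delta> by (subst sum_fib) auto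
  qed
  define b where "b w = (\<Sum>e\<in>E. \<Sum>e'\<in>E. card {g\<in>F. bd w g e e'})" for w
  \<comment> \<open>Exchanging the sums isolates each triple \<open>g\<close>, \<open>e\<close>,
    \<open>e'\<close>. The factor 2 collects \<delta> for every \<open>g\<close> in \<open>F\<close>
    and the at most \<open>\<delta> * card F\<close> elements that \<open>L\<close> moves out of
    \<open>F\<close>.\<close>
  have total_boundary: "(\<Sum>w\<in>{w\<in>Q. good w}. b w * measure M (fib w)) \<le> 2 * (card E)\<^sup>2 * (card F * \<delta>)"
  proof -
    have filter: "(\<Sum>w\<in>{w\<in>Q. good w}. if bd w g e e' then measure M (fib w) else 0)
        = (\<Sum>w\<in>{w\<in>Q. good w \<and> bd w g e e'}. measure M (fib w))" for g e e'
      using Q by (subst sum.inter_filter[symmetric]) (auto intro!: sum.cong)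
    have "(\<Sum>w\<in>{w\<in>Q. good w}. b w * measure M (fib w))
        = (\<Sum>w\<in>{w\<in>Q. good w}. \<Sum>e\<in>E. \<Sum>e'\<in>E. \<Sum>g\<in>F. if bd w g e e' then measure M (fib w) else 0)"
      using F by (intro sum.cong refl) (simp add: b_def sum_distrib_right sum.inter_filter[symmetric])
    also have "\<dots> = (\<Sum>e\<in>E. \<Sum>w\<in>{w\<in>Q. good w}. \<Sum>e'\<in>E. \<Sum>g\<in>F. if bd w g e e' then measure M (fib w) else 0)"
      by (rule sum.swap)
    also have "\<dots> = (\<Sum>e\<in>E. \<Sum>e'\<in>E. \<Sum>w\<in>{w\<in>Q. good w}. \<Sum>g\<in>F. if bd w g e e' then measure M (fib w) else 0)"
      by (intro sum.cong refl sum.swap)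
    also have "\<dots> = (\<Sum>e\<in>E. \<Sum>e'\<in>E. \<Sum>g\<in>F. \<Sum>w\<in>{w\<in>Q. good w}. if bd w g e e' then measure M (fib w) else 0)"
      by (intro sum.cong refl sum.swap)
    also have "\<dots> = (\<Sum>e\<in>E. \<Sum>e'\<in>E. \<Sum>g\<in>F. \<Sum>w\<in>{w\<in>Q. good w \<and> bd w g e e'}. measure M (fib w))"
      by (simp only: filter)
    also have "\<dots> \<le> (\<Sum>e\<in>E. \<Sum>e'\<in>E. \<Sum>g\<in>F. \<delta> + (if \<exists>l\<in>L. l \<otimes>\<^bsub>G\<^esub> g \<notin> F then 1 else 0))"
      by (intro sum_mono boundary)
    also have "\<dots> = (card E)\<^sup>2 * (card F * \<delta> + card {g\<in>F. \<exists>l\<in>L. l \<otimes>\<^bsub>G\<^esub> g \<notin> F})"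
      using F by (simp add: sum.distrib sum.inter_filter[symmetric] power2_eq_square)
    also have "\<dots> \<le> (card E)\<^sup>2 * (card F * \<delta> + card F * \<delta>)"
      using folner by (intro mult_left_mono add_left_mono) (auto simp: mult.commute)
    finally show ?thesis by (simp add: algebra_simps)
  qed
  have sets_X: "fib w \<inter> X\<^sub>0 \<in> sets M" for w using fib X\<^sub>0 by auto
  have r\<sigma>: "simple_function M (\<lambda>x. r (\<sigma> g x))" if "g \<in> F" for g
    using simple_function_comp_endo[OF r \<sigma>(1)] that F by auto
  have conull: "local_entropy (fib w \<inter> X\<^sub>0) h = local_entropy (fib w) h" if "simple_function M h" for h :: "'a \<Rightarrow> 'z" and w
    by (rule local_entropy_conull[OF that fib X\<^sub>0])
  \<comment> \<open>The cocycle description is valid on \<open>X\<^sub>0\<close> only, so the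
    inequality is applied to the part of the fibre in \<open>X\<^sub>0\<close> and then transferred
    to the whole fibre.\<close>
  have good_le: "card E * local_entropy (fib w) f
      \<le> (\<Sum>g\<in>F. local_entropy (fib w) (\<lambda>x. r (\<sigma> g x))) + b w * measure M (fib w) * (card E * C)"
    if w: "good w" for w
  proof -
    have "card E * local_entropy (fib w \<inter> X\<^sub>0) f
      \<le> (\<Sum>g\<in>F. local_entropy (fib w \<inter> X\<^sub>0) (\<lambda>x. r (\<sigma> g x)))
        + b w * (card E * (measure M (fib w \<inter> X\<^sub>0) * C))"
      unfolding f_def r_def \<sigma>_def b_def bd_def C_def
      by (rule piece_inequality[OF sets_X _ F E(1,2) e\<^sub>0 _ _ \<pi>]) (use c_\<Gamma> c_T w in auto)
    then show ?thesis
      using conull[OF f] conull[OF r\<sigma>] measure_Int_conull[OF fib[of w] X\<^sub>0]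
      by (simp add: mult_ac)
  qed
  have bad_le: "card E * local_entropy (fib w) f \<le> measure M (fib w) * (card E * (card F * C))" for w
  proof -
    have "local_entropy (fib w) f \<le> card F * (measure M (fib w) * C)"
      unfolding f_def C_def
    proof (intro local_entropy_joint_le F fib)
      fix g assume g: "g \<in> F"
      then show gs: "simple_function M (\<lambda>x. \<pi> (T g x))"
        using F simple_function_comp_endo[OF \<pi>(1) T_meas] by auto
      show "local_entropy (fib w) (\<lambda>x. \<pi> (T g x)) \<le> measure M (fib w) * ln (card V)"
        using g F \<pi>(2,3) by (intro local_entropy_le_ln_card gs fib) (auto simp: fib_def image_subset_iff)
    qed
    then have "card E * local_entropy (fib w) f \<le> card E * (card F * (measure M (fib w) * C))"
      by (intro mult_left_mono) auto
    then show ?thesis by (simp add: mult_ac)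
  qed
  have "card E * cond_part_entropy M S (fibers (space M) f) \<le> card E * cond_map_entropy f q"
    by (intro mult_left_mono cond_part_entropy_le subalgebra_S f q) auto
  also have "\<dots> = (\<Sum>w\<in>Q. card E * local_entropy (fib w) f)"
    by (simp add: cond_map_entropy_def Q_def fib_def sum_distrib_left)
  also have "\<dots> = (\<Sum>w\<in>{w\<in>Q. good w}. card E * local_entropy (fib w) f)
      + (\<Sum>w\<in>{w\<in>Q. \<not> good w}. card E * local_entropy (fib w) f)"
    using Q by (subst sum.union_disjoint[symmetric]) (auto intro!: sum.cong)
  also have "(\<Sum>w\<in>{w\<in>Q. good w}. card E * local_entropy (fib w) f)
      \<le> (\<Sum>w\<in>{w\<in>Q. good w}. (\<Sum>g\<in>F. local_entropy (fib w) (\<lambda>x. r (\<sigma> g x))) + b w * measure M (fib w) * (card E * C))"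
    by (intro sum_mono good_le) auto
  also have "\<dots> = (\<Sum>w\<in>{w\<in>Q. good w}. \<Sum>g\<in>F. local_entropy (fib w) (\<lambda>x. r (\<sigma> g x)))
      + (\<Sum>w\<in>{w\<in>Q. good w}. b w * measure M (fib w)) * (card E * C)"
    by (simp add: sum.distrib sum_distrib_right)
  also have "(\<Sum>w\<in>{w\<in>Q. good w}. b w * measure M (fib w)) * (card E * C)
      \<le> 2 * (card E)\<^sup>2 * (card F * \<delta>) * (card E * C)"
    using C by (intro mult_right_mono total_boundary) auto
  also have "(\<Sum>w\<in>{w\<in>Q. \<not> good w}. card E * local_entropy (fib w) f)
      \<le> (\<Sum>w\<in>{w\<in>Q. \<not> good w}. measure M (fib w) * (card E * (card F * C)))"
    by (intro sum_mono bad_le)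
  also have "\<dots> = (\<Sum>w\<in>{w\<in>Q. \<not> good w}. measure M (fib w)) * (card E * (card F * C))"
    by (simp add: sum_distrib_right)
  also have "\<dots> \<le> \<delta> * (card E * (card F * C))"
    using C by (intro mult_right_mono bad) auto
  also have "(\<Sum>w\<in>{w\<in>Q. good w}. \<Sum>g\<in>F. local_entropy (fib w) (\<lambda>x. r (\<sigma> g x)))
      \<le> card F * (cond_part_entropy M S (fibers (space M) r) + \<delta>)"
  proof -
    \<comment> \<open>Bad fibres are put back, which cannot decrease the sum, so that full
      conditional entropies given \<open>q\<close> appear. Refinement and invariance of the measure
      then reduce each to that of \<open>r\<close> given \<open>q\<^sub>0\<close>.\<close>
    have "(\<Sum>w\<in>{w\<in>Q. good w}. \<Sum>g\<in>F. local_entropy (fib w) (\<lambda>x. r (\<sigma> g x)))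
        \<le> (\<Sum>w\<in>Q. \<Sum>g\<in>F. local_entropy (fib w) (\<lambda>x. r (\<sigma> g x)))"
      using Q r\<sigma> by (intro sum_mono2 sum_nonneg local_entropy_nonneg fib) auto
    also have "\<dots> = (\<Sum>g\<in>F. cond_map_entropy (\<lambda>x. r (\<sigma> g x)) q)"
      by (subst sum.swap) (simp add: cond_map_entropy_def Q_def fib_def)
    also have "\<dots> \<le> (\<Sum>g\<in>F. cond_part_entropy M S (fibers (space M) r) + \<delta>)"
    proof (rule sum_mono)
      fix g assume g: "g \<in> F"
      then have gG: "g \<in> carrier G" using F by auto
      have "cond_map_entropy (\<lambda>x. r (\<sigma> g x)) q \<le> cond_map_entropy (\<lambda>x. r (\<sigma> g x)) (\<lambda>x. q\<^sub>0 (\<sigma> g x))"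
      proof (rule cond_map_entropy_refine[OF r\<sigma>[OF g] q_M simple_function_comp_endo[OF q\<^sub>0_M \<sigma>(1)[OF gG]]])
        fix x y assume "q x = q y"
        then show "q\<^sub>0 (\<sigma> g x) = q\<^sub>0 (\<sigma> g y)" using g by (auto simp: q_def joint_eq_iff)
      qed
      also have "\<dots> = cond_map_entropy r q\<^sub>0"
        by (rule cond_map_entropy_comp[OF r q\<^sub>0_M \<sigma>(1,2)[OF gG]])
      finally show "cond_map_entropy (\<lambda>x. r (\<sigma> g x)) q \<le> cond_part_entropy M S (fibers (space M) r) + \<delta>"
        using q\<^sub>0_le by simp
    qed
    finally show ?thesis by simp
  qed
  finally show ?thesis
    unfolding f_def[symmetric] r_def[symmetric] C_def[symmetric]
    by (simp add: algebra_simps power2_eq_square power3_eq_cube)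
qed

end

section \<open>Averages over finite sets and Folner boundaries\<close>

definition average_entropy ::
  "'a measure \<Rightarrow> 'a measure \<Rightarrow> 'a set set \<Rightarrow> ('g \<Rightarrow> 'a \<Rightarrow> 'a) \<Rightarrow> 'g set \<Rightarrow> real" where
  "average_entropy M S P T E = cond_part_entropy M S (joined_partition M T E P) / card E"

text \<open>The empty set is excluded because dividing by its cardinality yields 0, which would
  collapse the infimum of the averages.\<close>

definition finite_subsets :: "('g, 'r) monoid_scheme \<Rightarrow> 'g set set" where
  "finite_subsets G = {E. finite E \<and> E \<noteq> {} \<and> E \<subseteq> carrier G}"

lemma folner_seq_finite_subsets: "folner_seq G F \<Longrightarrow> F n \<in> finite_subsets G"
  by (auto simp: folner_seq_def finite_subsets_def)

text \<open>The elements that \<open>l\<close> keeps in \<open>F n\<close> form the intersection of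
  \<open>F n\<close> with its translate by the inverse of \<open>l\<close>, so the Folner condition
  at that inverse controls those that leave. The finitely many \<open>l\<close> are combined by a
  union bound.\<close>

lemma folner_seq_boundary:
  fixes G :: "('g, 'r) monoid_scheme" (structure) and \<delta> :: real
  assumes G: "group G" and F: "folner_seq G F" and L: "finite L" "L \<subseteq> carrier G" and \<delta>: "0 < \<delta>"
  shows "\<forall>\<^sub>F n in sequentially. card {g\<in>F n. \<exists>l\<in>L. l \<otimes> g \<notin> F n} \<le> \<delta> * card (F n)"
proof -
  interpret group G by (rule G)
  \<comment> \<open>Adding 1 in the denominator covers the case of empty \<open>L\<close>.\<close>
  define \<eta> where "\<eta> = \<delta> / (card L + 1)"
  have \<eta>: "0 < \<eta>" using \<delta> by (simp add: \<eta>_def add_nonneg_pos)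
  have "\<forall>\<^sub>F n in sequentially. card {g\<in>F n. l \<otimes> g \<notin> F n} \<le> \<eta> * card (F n)" if l: "l \<in> L" for l
  proof -
    have lG: "l \<in> carrier G" using l L by auto
    have "(\<lambda>n. real (card (F n \<inter> (inv l <# F n))) / real (card (F n))) \<longlonglongrightarrow> 1"
      using F lG by (simp add: folner_seq_def)
    then have "\<forall>\<^sub>F n in sequentially. 1 - \<eta> < card (F n \<inter> (inv l <# F n)) / card (F n)"
      using \<eta> by (intro order_tendstoD(1)[where y = 1]) auto
    then show ?thesis
    proof eventually_elim
      case (elim n)
      have Fn: "finite (F n)" "F n \<noteq> {}" "F n \<subseteq> carrier G" using F by (auto simp: folner_seq_def)
      have "F n \<inter> (inv l <# F n) = {g\<in>F n. l \<otimes> g \<in> F n}"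
      proof (intro equalityI subsetI)
        fix g assume "g \<in> F n \<inter> (inv l <# F n)"
        then obtain h where h: "g \<in> F n" "h \<in> F n" "g = inv l \<otimes> h" by (auto simp: l_coset_def)
        then have "l \<otimes> g = h" using lG Fn by (auto simp: m_assoc[symmetric] subset_eq)
        with h show "g \<in> {g\<in>F n. l \<otimes> g \<in> F n}" by simp
      next
        fix g assume g: "g \<in> {g\<in>F n. l \<otimes> g \<in> F n}"
        then have "g = inv l \<otimes> (l \<otimes> g)" using lG Fn by (auto simp: m_assoc[symmetric] subset_eq)
        with g show "g \<in> F n \<inter> (inv l <# F n)" by (auto simp: l_coset_def)
      qed
      moreover have "card (F n) = card {g\<in>F n. l \<otimes> g \<in> F n} + card {g\<in>F n. l \<otimes> g \<notin> F n}"
        using Fn by (subst card_Un_disjoint[symmetric]) (auto intro!: arg_cong[of _ _ card])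
      moreover have "0 < real (card (F n))" using Fn by (simp add: card_gt_0_iff)
      ultimately show ?case using elim by (simp add: field_simps)
    qed
  qed
  then have "\<forall>\<^sub>F n in sequentially. \<forall>l\<in>L. card {g\<in>F n. l \<otimes> g \<notin> F n} \<le> \<eta> * card (F n)"
    using L by (simp add: eventually_ball_finite_distrib)
  then show ?thesis
  proof eventually_elim
    case (elim n)
    have fin: "finite (F n)" using F by (auto simp: folner_seq_def)
    have "{g\<in>F n. \<exists>l\<in>L. l \<otimes> g \<notin> F n} = (\<Union>l\<in>L. {g\<in>F n. l \<otimes> g \<notin> F n})" by auto
    then have "card {g\<in>F n. \<exists>l\<in>L. l \<otimes> g \<notin> F n} \<le> (\<Sum>l\<in>L. card {g\<in>F n. l \<otimes> g \<notin> F n})"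
      using card_UN_le[OF L(1)] by simp
    then have "real (card {g\<in>F n. \<exists>l\<in>L. l \<otimes> g \<notin> F n}) \<le> (\<Sum>l\<in>L. real (card {g\<in>F n. l \<otimes> g \<notin> F n}))"
      unfolding of_nat_sum[symmetric] by (rule of_nat_mono)
    also have "\<dots> \<le> (\<Sum>l\<in>L. \<eta> * card (F n))" using elim by (intro sum_mono) auto
    also have "\<dots> = (card L * \<eta>) * card (F n)" by simp
    also have "\<dots> \<le> \<delta> * card (F n)"
      using \<delta> by (intro mult_right_mono) (auto simp: \<eta>_def field_simps)
    finally show ?case .
  qed
qed

context orbit_coupling
begin

lemma joined_partition_T:
  assumes "P \<in> finite_partitions M" "E \<in> finite_subsets G"
  shows "joined_partition M T E P = fibers (space M) (joint (\<lambda>g x. cell P (T g x)) E)"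
  using assms T.surj_prop
  by (intro joined_partition_eq_fibers) (auto simp: finite_partitions_def finite_subsets_def)

lemma joined_partition_U:
  assumes "P \<in> finite_partitions M" "E \<in> finite_subsets \<Gamma>"
  shows "joined_partition M U E P = fibers (space M) (joint (\<lambda>g x. cell P (U g x)) E)"
  using assms U.surj_prop
  by (intro joined_partition_eq_fibers) (auto simp: finite_partitions_def finite_subsets_def)

lemma average_entropy_nonneg:
  assumes "P \<in> finite_partitions M" "E \<in> finite_subsets G"
  shows "0 \<le> average_entropy M S P T E"
proof -
  have "simple_function M (joint (\<lambda>g x. cell P (T g x)) E)"
    using assms simple_function_comp_endo[OF simple_function_cell T_meas]
    by (intro simple_function_joint) (auto simp: finite_subsets_def)
  then have "0 \<le> cond_part_entropy M S (joined_partition M T E P)"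
    using assms by (simp add: joined_partition_T cond_part_entropy_nonneg[OF subalgebra_S])
  then show ?thesis by (simp add: average_entropy_def)
qed

text \<open>\<open>L\<close> and \<delta> depend on \<open>E\<close>, \<open>P\<close> and
  \<epsilon> but not on \<open>n\<close>, so \<open>F n\<close> is eventually invariant enough under
  \<open>L\<close> for \<open>finite_set_inequality\<close>.\<close>

lemma eventually_average_entropy_le:
  assumes P: "P \<in> finite_partitions M" and F: "folner_seq G F"
    and E: "E \<in> finite_subsets \<Gamma>" and \<epsilon>: "0 < \<epsilon>"
  shows "\<forall>\<^sub>F n in sequentially. average_entropy M S P T (F n) \<le> average_entropy M S P U E + \<epsilon>"
proof -
  have E': "finite E" "E \<subseteq> carrier \<Gamma>" "E \<noteq> {}" using E by (auto simp: finite_subsets_def)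
  have P': "finite P" "partition_on (space M) P" using P by (auto simp: finite_partitions_def)
  have img: "cell P ` space M \<subseteq> P" using cell(1)[OF P'(2)] by auto
  then have "P \<noteq> {}" using not_empty by auto
  then have lnP: "0 \<le> ln (card P)" using P' by (simp add: card_gt_0_iff Suc_le_eq)
  define \<kappa> where "\<kappa> = 1 + 2 * (card E) ^ 3 * ln (card P) + card E * ln (card P)"
  have \<kappa>: "1 \<le> \<kappa>" using lnP by (simp add: \<kappa>_def)
  have cE: "0 < real (card E)" using E' by (simp add: card_gt_0_iff)
  \<comment> \<open>Chosen so that the error \<open>\<delta> * \<kappa>\<close>, once divided by
    \<open>card E\<close>, is exactly \<epsilon>.\<close>
  define \<delta> where "\<delta> = \<epsilon> * card E / \<kappa>"
  have \<delta>: "0 < \<delta>" using \<epsilon> cE \<kappa> by (simp add: \<delta>_def)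
  define K where "K = (\<lambda>(e, e'). e' \<otimes>\<^bsub>\<Gamma>\<^esub> inv\<^bsub>\<Gamma>\<^esub> e) ` (E \<times> E)"
  have K: "finite K" "K \<subseteq> carrier \<Gamma>" using E' by (auto simp: K_def)
  have "\<exists>L\<subseteq>carrier G. finite L \<and> (\<forall>k\<in>K. measure M (space M - (\<Union>l\<in>L. D l k)) \<le> \<delta>)"
  proof (rule finite_cover_family[OF K(1) countable_G _ _ \<delta>])
    show "X\<^sub>0 \<subseteq> (\<Union>l\<in>carrier G. D l k)" if "k \<in> K" for k
      using that K ex_G D_iff by (auto simp: subset_eq)
  qed (use D K sets_S in auto)
  then obtain L where L: "L \<subseteq> carrier G" "finite L"
    "\<And>k. k \<in> K \<Longrightarrow> measure M (space M - (\<Union>l\<in>L. D l k)) \<le> \<delta>" by blast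
  from folner_seq_boundary[OF group_G F L(2,1) \<delta>] show ?thesis
  proof eventually_elim
    case (elim n)
    have Fn: "finite (F n)" "F n \<subseteq> carrier G" "0 < real (card (F n))"
      using F by (auto simp: folner_seq_def card_gt_0_iff)
    have "card E * cond_part_entropy M S (joined_partition M T (F n) P)
        \<le> card (F n) * (cond_part_entropy M S (joined_partition M U E P) + \<delta> * \<kappa>)"
      unfolding joined_partition_T[OF P folner_seq_finite_subsets[OF F]] joined_partition_U[OF P E] \<kappa>_def
    proof (rule finite_set_inequality[OF Fn(1,2) E' L(1) _ L(2) elim \<delta> simple_function_cell[OF P] P'(1) img])
      fix e e' assume "e \<in> E" "e' \<in> E"
      then have "e' \<otimes>\<^bsub>\<Gamma>\<^esub> inv\<^bsub>\<Gamma>\<^esub> e \<in> K" by (auto simp: K_def)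
      then show "measure M (space M - (\<Union>l\<in>L. D l (e' \<otimes>\<^bsub>\<Gamma>\<^esub> inv\<^bsub>\<Gamma>\<^esub> e))) \<le> \<delta>" by (rule L(3))
    qed
    also have "\<delta> * \<kappa> = \<epsilon> * card E" using \<kappa> by (simp add: \<delta>_def)
    finally show ?case using cE Fn by (simp add: average_entropy_def field_simps)
  qed
qed

end

section \<open>The cocycle is measurable for the factor\<close>

text \<open>A countable base of a Hausdorff topology separates points, and passing to a completion
  keeps its members measurable.\<close>

lemma standard_prob_space_separating:
  assumes "standard_prob_space N"
  shows "\<exists>\<B>. countable \<B> \<and> \<B> \<subseteq> sets N \<and>
    (\<forall>y\<in>space N. \<forall>z\<in>space N. y \<noteq> z \<longrightarrow> (\<exists>B\<in>\<B>. y \<in> B \<and> z \<notin> B))"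
proof -
  obtain B where B: "standard_borel_space B" "N = B \<or> N = completion B"
    using assms by (auto simp: standard_prob_space_def)
  have sub: "sets B \<subseteq> sets N" "space N = space B"
    using B(2) by (auto intro: sets_completionI_sets)
  obtain X where X: "completely_metrizable_space X" "second_countable X" "topspace X = space B"
    "sets B = sigma_sets (space B) {U. openin X U}"
    using B(1) by (auto simp: standard_borel_space_def)
  from X(2)[unfolded second_countable_def] obtain \<B> where \<B>: "countable \<B>" "\<forall>V\<in>\<B>. openin X V"
    "\<forall>U x. openin X U \<and> x \<in> U \<longrightarrow> (\<exists>V\<in>\<B>. x \<in> V \<and> V \<subseteq> U)"
    by (elim exE conjE)
  have "Hausdorff_space X"
    using X(1) by (simp add: completely_metrizable_imp_metrizable_space metrizable_imp_Hausdorff_space)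
  have "\<exists>V\<in>\<B>. y \<in> V \<and> z \<notin> V" if yz: "y \<in> space N" "z \<in> space N" "y \<noteq> z" for y z
  proof -
    obtain U U' where "openin X U" "openin X U'" "y \<in> U" "z \<in> U'" "disjnt U U'"
      using \<open>Hausdorff_space X\<close> yz sub X(3) unfolding Hausdorff_space_def by metis
    then show ?thesis using \<B>(3)[rule_format, of U y] by (auto simp: disjnt_iff)
  qed
  moreover have "\<B> \<subseteq> sets N" using \<B>(2) sub X(4) by (auto intro: sigma_sets.Basic)
  ultimately show ?thesis using \<B>(1) by blast
qed

text \<open>Two points differ exactly when some member of a countable separating family contains the
  first but not the second, so the set of disagreement is a countable union of measurable
  sets.\<close>

lemma sets_agreement:
  assumes N: "standard_prob_space N" and f: "f \<in> N \<rightarrow>\<^sub>M N" and g: "g \<in> N \<rightarrow>\<^sub>M N"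
  shows "{y\<in>space N. f y = g y} \<in> sets N"
proof -
  from standard_prob_space_separating[OF N] obtain \<B> where \<B>: "countable \<B>" "\<B> \<subseteq> sets N"
    "\<forall>y\<in>space N. \<forall>z\<in>space N. y \<noteq> z \<longrightarrow> (\<exists>B\<in>\<B>. y \<in> B \<and> z \<notin> B)"
    by (elim exE conjE)
  have "f y = g y \<longleftrightarrow> \<not> (\<exists>B\<in>\<B>. f y \<in> B \<and> g y \<notin> B)" if "y \<in> space N" for y
    using \<B>(3)[rule_format, OF measurable_space[OF f that] measurable_space[OF g that]]
    by (cases "f y = g y") auto
  then have "{y\<in>space N. f y = g y} = space N - (\<Union>B\<in>\<B>. (f -` B \<inter> space N) - (g -` B \<inter> space N))"
    by blast
  also have "\<dots> \<in> sets N"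
    using \<B> measurable_sets[OF f] measurable_sets[OF g]
    by (intro sets.compl_sets sets.countable_UN' sets.Diff) auto
  finally show ?thesis .
qed

lemma (in group_action) stabilizer_trivial_eq:
  assumes "stabilizer G \<phi> x = {\<one>}" "x \<in> E" "g \<in> carrier G" "h \<in> carrier G" "\<phi> g x = \<phi> h x"
  shows "g = h"
proof -
  interpret group G using group_hom group_hom.axioms(1) by auto
  have "\<phi> (inv h \<otimes> g) x = \<phi> (inv h) (\<phi> h x)"
    using assms composition_rule[of x "inv h" g] by simp
  also have "\<dots> = x" using orbit_sym_aux[OF assms(4,2) refl] .
  finally have "inv h \<otimes> g \<in> stabilizer G \<phi> x" using assms(3,4) by (simp add: stabilizer_def)
  then have "inv h \<otimes> g = \<one>" unfolding assms(1) by simp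
  then show ?thesis using assms by (metis inv_closed inv_equality inv_inv)
qed

lemma (in group_action) one_action: "x \<in> E \<Longrightarrow> \<phi> \<one> x = x"
  using id_eq_one by (metis restrict_apply')

lemma standard_prob_space_imp_prob_space: "standard_prob_space M \<Longrightarrow> prob_space M"
  by (auto simp: standard_prob_space_def intro: prob_space.prob_space_completion)

text \<open>\<open>D g k\<close> is a set of \<open>S\<close> that agrees modulo null sets with the
  preimage of the agreement set of \<open>g\<close> and \<open>k\<close> on the factor. Freeness
  there lifts agreement from the factor to \<open>X\<close>, and freeness itself lifts along the
  equivariant map \<open>p\<close>.\<close>

lemma orbit_coupling_exists:
  fixes M S :: "'a measure" and N :: "'b measure" and p :: "'a \<Rightarrow> 'b"
    and G :: "('g, 'r) monoid_scheme" and \<Gamma> :: "('h, 's) monoid_scheme"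
    and T :: "'g \<Rightarrow> 'a \<Rightarrow> 'a" and U :: "'h \<Rightarrow> 'a \<Rightarrow> 'a"
    and TY :: "'g \<Rightarrow> 'b \<Rightarrow> 'b" and UY :: "'h \<Rightarrow> 'b \<Rightarrow> 'b"
  assumes "standard_prob_space M"
    and G: "countable_amenable_group G" and \<Gamma>: "countable_amenable_group \<Gamma>"
    and T: "pmp_action M G T" and U: "pmp_action M \<Gamma> U"
    and orbits: "same_orbits M G T \<Gamma> U"
    and inv: "invariant_subalgebra M G T S" "invariant_subalgebra M \<Gamma> U S"
    and factor: "factor_space M S N p"
    and TY: "factor_action M G T N p TY" and UY: "factor_action M \<Gamma> U N p UY"
    and free: "free_action N G TY" "free_action N \<Gamma> UY"
  shows "\<exists>D X\<^sub>0. orbit_coupling M S G T \<Gamma> U D X\<^sub>0"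
proof -
  interpret M: prob_space M by (rule standard_prob_space_imp_prob_space) fact
  interpret G: group G using G by (simp add: countable_amenable_group_def)
  interpret \<Gamma>: group \<Gamma> using \<Gamma> by (simp add: countable_amenable_group_def)
  have cG: "countable (carrier G)" and c\<Gamma>: "countable (carrier \<Gamma>)"
    using G \<Gamma> by (auto simp: countable_amenable_group_def)
  interpret T: group_action G "space M" T using T by (simp add: pmp_action_def)
  interpret U: group_action \<Gamma> "space M" U using U by (simp add: pmp_action_def)
  interpret TY: group_action G "space N" TY using TY by (simp add: factor_action_def pmp_action_def)
  interpret UY: group_action \<Gamma> "space N" UY using UY by (simp add: factor_action_def pmp_action_def)
  have N: "standard_prob_space N" and p: "p \<in> M \<rightarrow>\<^sub>M N" "distr M N p = N"
    using factor by (auto simp: factor_space_def)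
  define agree where "agree g k = {y\<in>space N. TY g y = UY k y}" for g k
  have "\<exists>A\<in>sets S. sym_diff A (p -` agree g k \<inter> space M) \<in> null_sets M"
    if "g \<in> carrier G" "k \<in> carrier \<Gamma>" for g k
  proof -
    have "agree g k \<in> sets N"
      unfolding agree_def using that TY UY
      by (intro sets_agreement N) (auto simp: factor_action_def pmp_action_def)
    then show ?thesis using factor by (auto simp: factor_space_def)
  qed
  then obtain D where D: "\<And>g k. g \<in> carrier G \<Longrightarrow> k \<in> carrier \<Gamma> \<Longrightarrow> D g k \<in> sets S"
    "\<And>g k. g \<in> carrier G \<Longrightarrow> k \<in> carrier \<Gamma> \<Longrightarrow>
      sym_diff (D g k) (p -` agree g k \<inter> space M) \<in> null_sets M"
    by metis
  define good where "good x \<longleftrightarrow>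
      (\<forall>g\<in>carrier G. \<forall>k\<in>carrier \<Gamma>. x \<in> D g k \<longleftrightarrow> x \<in> p -` agree g k \<inter> space M) \<and>
      (\<forall>g\<in>carrier G. p (T g x) = TY g (p x)) \<and> (\<forall>k\<in>carrier \<Gamma>. p (U k x) = UY k (p x)) \<and>
      stabilizer G TY (p x) = {\<one>\<^bsub>G\<^esub>} \<and> stabilizer \<Gamma> UY (p x) = {\<one>\<^bsub>\<Gamma>\<^esub>} \<and>
      orbit G T x = orbit \<Gamma> U x" for x
  have "AE x in M. good x"
    unfolding good_def
  proof (intro AE_conjI)
    have "AE x in M. x \<in> D g k \<longleftrightarrow> x \<in> p -` agree g k \<inter> space M"
      if "g \<in> carrier G" "k \<in> carrier \<Gamma>" for g k
      using AE_not_in[OF D(2)[OF that]] by eventually_elim auto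
    then show "AE x in M. \<forall>g\<in>carrier G. \<forall>k\<in>carrier \<Gamma>. x \<in> D g k \<longleftrightarrow> x \<in> p -` agree g k \<inter> space M"
      using cG c\<Gamma> by (simp add: AE_ball_countable)
    show "AE x in M. \<forall>g\<in>carrier G. p (T g x) = TY g (p x)"
      using TY cG by (simp add: factor_action_def AE_ball_countable)
    show "AE x in M. \<forall>k\<in>carrier \<Gamma>. p (U k x) = UY k (p x)"
      using UY c\<Gamma> by (simp add: factor_action_def AE_ball_countable)
    \<comment> \<open>Almost sure freeness on \<open>N\<close> pulls back along \<open>p\<close>,
      because \<open>N\<close> is the image measure.\<close>
    show "AE x in M. stabilizer G TY (p x) = {\<one>\<^bsub>G\<^esub>}"
      by (rule AE_distrD[OF p(1)]) (unfold p(2), use free(1) in \<open>simp add: free_action_def\<close>)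
    show "AE x in M. stabilizer \<Gamma> UY (p x) = {\<one>\<^bsub>\<Gamma>\<^esub>}"
      by (rule AE_distrD[OF p(1)]) (unfold p(2), use free(2) in \<open>simp add: free_action_def\<close>)
    show "AE x in M. orbit G T x = orbit \<Gamma> U x" using orbits by (simp add: same_orbits_def)
  qed
  then obtain Z where Z: "{x\<in>space M. \<not> good x} \<subseteq> Z" "Z \<in> null_sets M"
    by (auto elim!: AE_E intro: null_setsI)
  \<comment> \<open>Removing every preimage of \<open>Z\<close> under \<open>G\<close> makes the
    remaining set invariant under \<open>G\<close>; it is still conull as \<open>G\<close> is
    countable and preserves null sets.\<close>
  define X\<^sub>0 where "X\<^sub>0 = space M - (\<Union>g\<in>carrier G. T g -` Z \<inter> space M)"
  have Tm: "T g \<in> M \<rightarrow>\<^sub>M M" "distr M M (T g) = M" if "g \<in> carrier G" for g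
    using T that by (auto simp: pmp_action_def)
  have null: "(\<Union>g\<in>carrier G. T g -` Z \<inter> space M) \<in> null_sets M"
  proof (rule null_sets_UN'[OF cG])
    fix g assume g: "g \<in> carrier G"
    have "Z \<in> null_sets (distr M M (T g))" using Z(2) Tm[OF g] by simp
    then show "T g -` Z \<inter> space M \<in> null_sets M" unfolding null_sets_distr_iff[OF Tm(1)[OF g]] by simp
  qed
  have X\<^sub>0: "X\<^sub>0 \<in> sets M" "measure M (space M - X\<^sub>0) = 0"
  proof -
    show "X\<^sub>0 \<in> sets M" using null by (auto simp: X\<^sub>0_def)
    have "space M - X\<^sub>0 = (\<Union>g\<in>carrier G. T g -` Z \<inter> space M)" by (auto simp: X\<^sub>0_def)
    then show "measure M (space M - X\<^sub>0) = 0" using null by (simp add: measure_eq_0_null_sets)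
  qed
  have Tsp: "T g x \<in> space M" if "g \<in> carrier G" "x \<in> space M" for g x
    using measurable_space[OF Tm(1)] that by blast
  have X\<^sub>0_inv: "T g x \<in> X\<^sub>0" if "x \<in> X\<^sub>0" "g \<in> carrier G" for x g
    using that Tsp by (auto simp: X\<^sub>0_def T.composition_rule[symmetric])
  have sp: "x \<in> space M" "p x \<in> space N" if "x \<in> X\<^sub>0" for x
    using that measurable_space[OF p(1)] by (auto simp: X\<^sub>0_def)
  have good: "good x" if "x \<in> X\<^sub>0" for x
  proof -
    \<comment> \<open>The identity of \<open>G\<close> shows that \<open>Z\<close> itself was
      removed.\<close>
    have "T \<one>\<^bsub>G\<^esub> x \<notin> Z" using that by (auto simp: X\<^sub>0_def)
    then show ?thesis using T.one_action sp[OF that] Z(1) by auto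
  qed
  have free_G: "g = h" if "x \<in> X\<^sub>0" "g \<in> carrier G" "h \<in> carrier G" "TY g (p x) = TY h (p x)" for x g h
    using good[OF that(1)] sp[OF that(1)] that unfolding good_def
    by (intro TY.stabilizer_trivial_eq[of "p x"]) auto
  have free_\<Gamma>: "k = l" if "x \<in> X\<^sub>0" "k \<in> carrier \<Gamma>" "l \<in> carrier \<Gamma>" "UY k (p x) = UY l (p x)" for x k l
    using good[OF that(1)] sp[OF that(1)] that unfolding good_def
    by (intro UY.stabilizer_trivial_eq[of "p x"]) auto
  have pT: "p (T g x) = TY g (p x)" if "x \<in> X\<^sub>0" "g \<in> carrier G" for x g
    using good[OF that(1)] that unfolding good_def by blast
  have pU: "p (U k x) = UY k (p x)" if "x \<in> X\<^sub>0" "k \<in> carrier \<Gamma>" for x k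
    using good[OF that(1)] that unfolding good_def by blast
  have orb: "orbit G T x = orbit \<Gamma> U x" if "x \<in> X\<^sub>0" for x
    using good[OF that] unfolding good_def by blast
  have ex_\<Gamma>: "\<exists>k\<in>carrier \<Gamma>. T g x = U k x" if "x \<in> X\<^sub>0" "g \<in> carrier G" for x g
  proof -
    have "T g x \<in> orbit \<Gamma> U x" using orb[OF that(1)] that(2) by (auto simp: orbit_def)
    then show ?thesis by (auto simp: orbit_def)
  qed
  have ex_G: "\<exists>g\<in>carrier G. T g x = U k x" if "x \<in> X\<^sub>0" "k \<in> carrier \<Gamma>" for x k
  proof -
    have "U k x \<in> orbit G T x" using orb[OF that(1)] that(2) by (auto simp: orbit_def)
    then show ?thesis by (auto simp: orbit_def)
  qed
  have D_iff: "x \<in> D g k \<longleftrightarrow> T g x = U k x" if "x \<in> X\<^sub>0" "g \<in> carrier G" "k \<in> carrier \<Gamma>" for x g k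
  proof -
    note x = that
    have "x \<in> D g k \<longleftrightarrow> TY g (p x) = UY k (p x)"
      using good[OF that(1)] that sp[OF that(1)] by (auto simp: good_def agree_def)
    also have "\<dots> \<longleftrightarrow> T g x = U k x"
    proof
      assume eq: "TY g (p x) = UY k (p x)"
      \<comment> \<open>Common orbits give some \<open>l\<close> moving \<open>x\<close> to
        \<open>T g x\<close>. On the factor \<open>l\<close> and \<open>k\<close> then agree at
        \<open>p x\<close>, so freeness gives l = k.\<close>
      obtain l where l: "l \<in> carrier \<Gamma>" "T g x = U l x" using ex_\<Gamma>[OF x(1,2)] by blast
      then have "UY l (p x) = UY k (p x)"
        using eq pT[OF that(1,2)] pU[OF that(1) l(1)] by simp
      then show "T g x = U k x" using free_\<Gamma>[OF that(1) l(1) that(3)] l(2) by simp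
    next
      assume "T g x = U k x"
      then show "TY g (p x) = UY k (p x)" using pT[OF that(1,2)] pU[OF that(1,3)] by simp
    qed
    finally show ?thesis .
  qed
  have "orbit_coupling M S G T \<Gamma> U D X\<^sub>0"
  proof
    show "g = h" if "x \<in> X\<^sub>0" "g \<in> carrier G" "h \<in> carrier G" "T g x = T h x" for x g h
      using that(4) pT[OF that(1,2)] pT[OF that(1,3)] by (intro free_G[OF that(1-3)]) simp
    show "k = l" if "x \<in> X\<^sub>0" "k \<in> carrier \<Gamma>" "l \<in> carrier \<Gamma>" "U k x = U l x" for x k l
      using that(4) pU[OF that(1,2)] pU[OF that(1,3)] by (intro free_\<Gamma>[OF that(1-3)]) simp
  qed (fact | use D in blast)+
  then show ?thesis by blast
qed

section \<open>Equality of entropies\<close>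

text \<open>The outcome of a coupling without its witnesses \<open>D\<close> and
  \<open>X\<^sub>0\<close>, so that several couplings can be used side by side.\<close>

definition entropy_dominated ::
  "'a measure \<Rightarrow> 'a measure \<Rightarrow> 'a set set \<Rightarrow> ('g, 'r) monoid_scheme \<Rightarrow> ('g \<Rightarrow> 'a \<Rightarrow> 'a) \<Rightarrow>
   ('h, 's) monoid_scheme \<Rightarrow> ('h \<Rightarrow> 'a \<Rightarrow> 'a) \<Rightarrow> bool" where
  "entropy_dominated M S P G T \<Gamma> U \<longleftrightarrow>
    (\<forall>E\<in>finite_subsets G. 0 \<le> average_entropy M S P T E) \<and>
    (\<forall>F E \<epsilon>. folner_seq G F \<longrightarrow> E \<in> finite_subsets \<Gamma> \<longrightarrow> 0 < \<epsilon> \<longrightarrow>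
      (\<forall>\<^sub>F n in sequentially. average_entropy M S P T (F n) \<le> average_entropy M S P U E + \<epsilon>))"

lemma average_entropy_bdd_below:
  "entropy_dominated M S P G T \<Gamma> U \<Longrightarrow> bdd_below (average_entropy M S P T ` finite_subsets G)"
  by (intro bdd_belowI[of _ 0]) (auto simp: entropy_dominated_def)

text \<open>Each \<open>F n\<close> is itself a finite subset, so no average falls below the
  infimum; comparing the action with itself brings the averages eventually below any number above
  the infimum. The limit thus exists and is the same for all Folner sequences.\<close>

lemma action_part_entropy_eq_INF:
  assumes dom: "entropy_dominated M S P G T G T" and F: "folner_seq G F"
  shows "action_part_entropy M G T S P = (INF E\<in>finite_subsets G. average_entropy M S P T E)"
proof -
  let ?a = "average_entropy M S P T"
  let ?h = "INF E\<in>finite_subsets G. ?a E"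
  have lim: "(\<lambda>n. ?a (F n)) \<longlonglongrightarrow> ?h" if F: "folner_seq G F" for F
  proof (rule order_tendstoI)
    fix c assume c: "c < ?h"
    have "?h \<le> ?a (F n)" for n
      by (intro cINF_lower average_entropy_bdd_below[OF dom] folner_seq_finite_subsets F)
    with c show "\<forall>\<^sub>F n in sequentially. c < ?a (F n)" by (auto intro: less_le_trans always_eventually)
  next
    fix c assume c: "?h < c"
    have "finite_subsets G \<noteq> {}" using folner_seq_finite_subsets[OF F] by auto
    with c obtain E where E: "E \<in> finite_subsets G" "?a E < c"
      using cInf_lessD[of "?a ` finite_subsets G" c] by auto
    have "\<forall>\<^sub>F n in sequentially. ?a (F n) \<le> ?a E + (c - ?a E) / 2"
      using dom F E unfolding entropy_dominated_def by simp
    then show "\<forall>\<^sub>F n in sequentially. ?a (F n) < c"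
      by eventually_elim (use E in \<open>simp add: field_simps\<close>)
  qed
  show ?thesis
    unfolding action_part_entropy_def average_entropy_def[symmetric]
  \<comment> \<open>Uniqueness rests on the given Folner sequence; without one, every
    \<open>h\<close> would satisfy the description vacuously.\<close>
  proof (rule the_equality)
    fix h assume "\<forall>F. folner_seq G F \<longrightarrow> (\<lambda>n. ?a (F n)) \<longlonglongrightarrow> h"
    with F lim[OF F] show "h = ?h" using LIMSEQ_unique by blast
  qed (use lim in blast)
qed

text \<open>A single late \<open>F n\<close> already witnesses that the infimum over
  \<open>G\<close> is at most a given average over \<Gamma> plus \<epsilon>.\<close>

lemma INF_average_entropy_le:
  assumes dom: "entropy_dominated M S P G T \<Gamma> U" and F: "folner_seq G F" and K: "folner_seq \<Gamma> K"
  shows "(INF E\<in>finite_subsets G. average_entropy M S P T E)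
    \<le> (INF E\<in>finite_subsets \<Gamma>. average_entropy M S P U E)"
proof (rule cINF_greatest)
  show "finite_subsets \<Gamma> \<noteq> {}" using folner_seq_finite_subsets[OF K] by auto
  fix E assume E: "E \<in> finite_subsets \<Gamma>"
  show "(INF E\<in>finite_subsets G. average_entropy M S P T E) \<le> average_entropy M S P U E"
  proof (rule field_le_epsilon)
    fix \<epsilon> :: real assume "0 < \<epsilon>"
    then have "\<forall>\<^sub>F n in sequentially. average_entropy M S P T (F n) \<le> average_entropy M S P U E + \<epsilon>"
      using dom F E unfolding entropy_dominated_def by simp
    then obtain n where "average_entropy M S P T (F n) \<le> average_entropy M S P U E + \<epsilon>"
      using eventually_happens' trivial_limit_sequentially by blast
    moreover have "(INF E\<in>finite_subsets G. average_entropy M S P T E) \<le> average_entropy M S P T (F n)"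
      by (intro cINF_lower average_entropy_bdd_below[OF dom] folner_seq_finite_subsets F)
    ultimately show "(INF E\<in>finite_subsets G. average_entropy M S P T E) \<le> average_entropy M S P U E + \<epsilon>"
      by linarith
  qed
qed

lemma orbit_coupling_entropy_dominated:
  assumes "\<exists>D X\<^sub>0. orbit_coupling M S G T \<Gamma> U D X\<^sub>0" and "P \<in> finite_partitions M"
  shows "entropy_dominated M S P G T \<Gamma> U"
proof -
  obtain D X\<^sub>0 where "orbit_coupling M S G T \<Gamma> U D X\<^sub>0" using assms(1) by blast
  then interpret orbit_coupling M S G T \<Gamma> U D X\<^sub>0 .
  show ?thesis
    unfolding entropy_dominated_def
    using average_entropy_nonneg eventually_average_entropy_le assms(2) by blast
qed

theorem theorem6p2:
  fixes M S :: "'a measure" and N :: "'b measure" and p :: "'a \<Rightarrow> 'b"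
    and G :: "('g, 'r) monoid_scheme" and \<Gamma> :: "('h, 's) monoid_scheme"
    and T :: "'g \<Rightarrow> 'a \<Rightarrow> 'a" and U :: "'h \<Rightarrow> 'a \<Rightarrow> 'a"
    and TY :: "'g \<Rightarrow> 'b \<Rightarrow> 'b" and UY :: "'h \<Rightarrow> 'b \<Rightarrow> 'b"
  assumes "standard_prob_space M"
    and "countable_amenable_group G" and "countable_amenable_group \<Gamma>"
    and "pmp_action M G T" and "pmp_action M \<Gamma> U"
    and "same_orbits M G T \<Gamma> U"
    and "invariant_subalgebra M G T S" and "invariant_subalgebra M \<Gamma> U S"
    and "factor_space M S N p"
    and "factor_action M G T N p TY" and "factor_action M \<Gamma> U N p UY"
    and "free_action N G TY" and "free_action N \<Gamma> UY"
  shows "action_entropy M G T S = action_entropy M \<Gamma> U S"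
proof -
  have orbits: "same_orbits M \<Gamma> U G T" "same_orbits M G T G T" "same_orbits M \<Gamma> U \<Gamma> U"
    using assms(6) by (auto simp: same_orbits_def elim: eventually_mono)
  note dom = orbit_coupling_entropy_dominated[OF orbit_coupling_exists]
  obtain F K where F: "folner_seq G F" and K: "folner_seq \<Gamma> K"
    using assms(2,3) by (auto simp: countable_amenable_group_def)
  have "action_part_entropy M G T S P = action_part_entropy M \<Gamma> U S P"
    if P: "P \<in> finite_partitions M" for P
  proof -
    \<comment> \<open>Coupling each action with itself identifies its entropy with an infimum; the
      two mixed couplings then give both inequalities between the infima.\<close>
    have "entropy_dominated M S P G T G T"
      by (rule dom[OF assms(1,2,2,4,4) orbits(2) assms(7,7,9,10,10,12,12) P])
    moreover have "entropy_dominated M S P \<Gamma> U \<Gamma> U"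
      by (rule dom[OF assms(1,3,3,5,5) orbits(3) assms(8,8,9,11,11,13,13) P])
    moreover have "entropy_dominated M S P G T \<Gamma> U"
      by (rule dom[OF assms P])
    moreover have "entropy_dominated M S P \<Gamma> U G T"
      by (rule dom[OF assms(1,3,2,5,4) orbits(1) assms(8,7,9,11,10,13,12) P])
    ultimately show ?thesis
      using INF_average_entropy_le F K action_part_entropy_eq_INF by (metis order_antisym)
  qed
  then show ?thesis unfolding action_entropy_def by (intro SUP_cong) auto
qed

end
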